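(* Every instance of EndOfPotentialLine can be mapped in polynomial time to an instance of EndOfMeteredLine such that from any solution of the latter a solution of the former can be constructed in linear time.
   Context: EndOfMeteredLine: given Boolean circuits $S,P:\{0,1\}^n\to\{0,1\}^n$ and $V:\{0,1\}^n\to\{0,\dots,2^n\}$ such that $P(0^n)=0^n\ne S(0^n)$ and $V(0^n)=1$, find $x\in\{0,1\}^n$ satisfying one of: (T1) $S(P(x))\ne x\ne 0^n$ or $P(S(x))\ne x$; (T2) $x\ne 0^n$ and $V(x)=1$; (T3) either $V(x)>0$ and $V(S(x))-V(x)\ne 1$, or $V(x)>1$ and $V(x)-V(P(x))\ne 1$. EndOfPotentialLine: given Boolean circuits $S,P:\{0,1\}^n\to\{0,1\}^n$ with $P(0^n)=0^n\ne S(0^n)$ and a Boolean circuit $V:\{0,1\}^n\to\{0,1,\dots,2^m-1\}$ with $V(0^n)=0$, find one of: (R1) $x\in\{0,1\}^n$ with $S(P(x))\ne x\ne 0^n$ or $P(S(x))\ne x$; (R2) $x\in\{0,1\}^n$ with $x\ne S(x)$, $P(S(x))=x$ and $V(S(x))-V(x)\le 0$. Time bounds are in terms of the size of the input circuits. *)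

theory Defs
  imports "HOL-Computational_Algebra.Polynomial"
begin

section \<open>Boolean circuits\<close>

text \<open>
  A circuit is a straight-line program over constants, NOT, AND and OR.  Wires are numbered
  consecutively: wires below \<open>inputs C\<close> carry the inputs, and the \<open>i\<close>-th gate drives
  wire \<open>inputs C + i\<close>.  Gates refer to their operands by wire number.
\<close>

datatype gate = ConstG bool | NotG nat | AndG nat nat | OrG nat nat

fun operands :: "gate \<Rightarrow> nat set" where
  "operands (ConstG b) = {}"
| "operands (NotG i) = {i}"
| "operands (AndG i j) = {i, j}"
| "operands (OrG i j) = {i, j}"

fun gate_value :: "bool list \<Rightarrow> gate \<Rightarrow> bool" where
  "gate_value ws (ConstG b) = b"
| "gate_value ws (NotG i) = (\<not> ws ! i)"
| "gate_value ws (AndG i j) = (ws ! i \<and> ws ! j)"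
| "gate_value ws (OrG i j) = (ws ! i \<or> ws ! j)"

record circuit =
  inputs :: nat
  gates :: "gate list"
  outputs :: "nat list"

definition wires :: "circuit \<Rightarrow> bool list \<Rightarrow> bool list" where
  "wires C x = foldl (\<lambda>ws g. ws @ [gate_value ws g]) x (gates C)"

definition ceval :: "circuit \<Rightarrow> bool list \<Rightarrow> bool list" where
  "ceval C x = map (\<lambda>i. wires C x ! i) (outputs C)"

definition circuit_wf :: "circuit \<Rightarrow> bool" where
  "circuit_wf C \<longleftrightarrow>
     (\<forall>i < length (gates C). \<forall>j \<in> operands (gates C ! i). j < inputs C + i) \<and>
     (\<forall>j \<in> set (outputs C). j < inputs C + length (gates C))"

definition is_circuit :: "nat \<Rightarrow> nat \<Rightarrow> circuit \<Rightarrow> bool" where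
  "is_circuit n k C \<longleftrightarrow> circuit_wf C \<and> inputs C = n \<and> length (outputs C) = k"

definition circuit_size :: "circuit \<Rightarrow> nat" where
  "circuit_size C = inputs C + length (gates C) + length (outputs C)"

text \<open>Bit strings are read as binary numbers, least significant bit first.\<close>

definition bits_value :: "bool list \<Rightarrow> nat" where
  "bits_value bs = horner_sum of_bool 2 bs"

abbreviation zeros :: "nat \<Rightarrow> bool list" where
  "zeros n \<equiv> replicate n False"


section \<open>The two search problems\<close>

text \<open>Instances of both problems consist of three circuits \<open>S\<close>, \<open>P\<close> and \<open>V\<close>.\<close>

record line_instance =
  circuit_S :: circuit
  circuit_P :: circuit
  circuit_V :: circuit

definition dim :: "line_instance \<Rightarrow> nat" where
  "dim I = inputs (circuit_S I)"

definition succ_of :: "line_instance \<Rightarrow> bool list \<Rightarrow> bool list" where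
  "succ_of I x = ceval (circuit_S I) x"

definition pred_of :: "line_instance \<Rightarrow> bool list \<Rightarrow> bool list" where
  "pred_of I x = ceval (circuit_P I) x"

definition val_of :: "line_instance \<Rightarrow> bool list \<Rightarrow> int" where
  "val_of I x = int (bits_value (ceval (circuit_V I) x))"

definition instance_size :: "line_instance \<Rightarrow> nat" where
  "instance_size I =
     circuit_size (circuit_S I) + circuit_size (circuit_P I) + circuit_size (circuit_V I)"

text \<open>
  A circuit with values in \<open>{0,\<dots>,2^n}\<close> has \<open>n + 1\<close> output bits, and the bound \<open>2^n\<close>
  has to hold on every input.
\<close>

definition EOML_instance :: "line_instance \<Rightarrow> bool" where
  "EOML_instance I \<longleftrightarrow>
     (let n = dim I in
        is_circuit n n (circuit_S I) \<and> is_circuit n n (circuit_P I) \<and>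
        is_circuit n (n + 1) (circuit_V I) \<and>
        (\<forall>x. length x = n \<longrightarrow> val_of I x \<le> 2 ^ n) \<and>
        pred_of I (zeros n) = zeros n \<and> succ_of I (zeros n) \<noteq> zeros n \<and>
        val_of I (zeros n) = 1)"

definition EOML_solution :: "line_instance \<Rightarrow> bool list \<Rightarrow> bool" where
  "EOML_solution I x \<longleftrightarrow>
     (let n = dim I; S = succ_of I; P = pred_of I; V = val_of I in
        length x = n \<and>
        (S (P x) \<noteq> x \<and> x \<noteq> zeros n \<or> P (S x) \<noteq> x \<or>
         x \<noteq> zeros n \<and> V x = 1 \<or>
         V x > 0 \<and> V (S x) - V x \<noteq> 1 \<or>
         V x > 1 \<and> V x - V (P x) \<noteq> 1))"

definition EOPL_instance :: "line_instance \<Rightarrow> bool" where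
  "EOPL_instance I \<longleftrightarrow>
     (let n = dim I in
        is_circuit n n (circuit_S I) \<and> is_circuit n n (circuit_P I) \<and>
        (\<exists>m. is_circuit n m (circuit_V I)) \<and>
        pred_of I (zeros n) = zeros n \<and> succ_of I (zeros n) \<noteq> zeros n \<and>
        val_of I (zeros n) = 0)"

definition EOPL_solution :: "line_instance \<Rightarrow> bool list \<Rightarrow> bool" where
  "EOPL_solution I x \<longleftrightarrow>
     (let n = dim I; S = succ_of I; P = pred_of I; V = val_of I in
        length x = n \<and>
        (S (P x) \<noteq> x \<and> x \<noteq> zeros n \<or> P (S x) \<noteq> x \<or>
         x \<noteq> S x \<and> P (S x) = x \<and> V (S x) - V x \<le> 0))"


section \<open>Random access machines with uniform cost\<close>

text \<open>
  The machine has registers and arrays of natural numbers; a program mentions only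
  finitely many of them.  Arithmetic is limited to increment and decrement, so a word can
  exceed the largest input word and program constant by at most the number of steps taken.
  Unit cost per instruction therefore cannot be exploited by packing data into huge words,
  and polynomial time agrees with polynomial time on Turing machines.
\<close>

datatype test = Less nat nat | Equal nat nat

datatype com =
    Skip
  | Const nat nat
  | Copy nat nat
  | Inc nat
  | Dec nat
  | Load nat nat nat
  | Store nat nat nat
  | Seq com com
  | Cond test com com
  | Loop test com

record state =
  reg :: "nat \<Rightarrow> nat"
  arr :: "nat \<Rightarrow> nat \<Rightarrow> nat"

fun holds :: "test \<Rightarrow> state \<Rightarrow> bool" where
  "holds (Less x y) s \<longleftrightarrow> reg s x < reg s y"
| "holds (Equal x y) s \<longleftrightarrow> reg s x = reg s y"

definition set_reg :: "nat \<Rightarrow> nat \<Rightarrow> state \<Rightarrow> state" where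
  "set_reg x v s = s\<lparr>reg := (reg s)(x := v)\<rparr>"

definition set_arr :: "nat \<Rightarrow> nat \<Rightarrow> nat \<Rightarrow> state \<Rightarrow> state" where
  "set_arr a i v s = s\<lparr>arr := (arr s)(a := (arr s a)(i := v))\<rparr>"

text \<open>
  \<open>exec c s t s'\<close>: started in \<open>s\<close>, the program \<open>c\<close> halts in \<open>s'\<close> after \<open>t\<close> steps.
  \<open>Load x a y\<close> reads cell \<open>reg s y\<close> of array \<open>a\<close> into register \<open>x\<close>, and
  \<open>Store a x y\<close> writes register \<open>y\<close> to cell \<open>reg s x\<close> of array \<open>a\<close>.
\<close>

inductive exec :: "com \<Rightarrow> state \<Rightarrow> nat \<Rightarrow> state \<Rightarrow> bool" where
  Skip: "exec Skip s 1 s"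
| Const: "exec (Const x k) s 1 (set_reg x k s)"
| Copy: "exec (Copy x y) s 1 (set_reg x (reg s y) s)"
| Inc: "exec (Inc x) s 1 (set_reg x (reg s x + 1) s)"
| Dec: "exec (Dec x) s 1 (set_reg x (reg s x - 1) s)"
| Load: "exec (Load x a y) s 1 (set_reg x (arr s a (reg s y)) s)"
| Store: "exec (Store a x y) s 1 (set_arr a (reg s x) (reg s y) s)"
| Seq: "exec c s t s' \<Longrightarrow> exec d s' t' s'' \<Longrightarrow> exec (Seq c d) s (t + t') s''"
| CondTrue: "holds b s \<Longrightarrow> exec c s t s' \<Longrightarrow> exec (Cond b c d) s (t + 1) s'"
| CondFalse: "\<not> holds b s \<Longrightarrow> exec d s t s' \<Longrightarrow> exec (Cond b c d) s (t + 1) s'"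
| LoopFalse: "\<not> holds b s \<Longrightarrow> exec (Loop b c) s 1 s"
| LoopTrue: "holds b s \<Longrightarrow> exec c s t s' \<Longrightarrow> exec (Loop b c) s' t' s'' \<Longrightarrow>
    exec (Loop b c) s (t + t' + 1) s''"

text \<open>
  The \<open>i\<close>-th argument (\<open>i \<ge> 1\<close>), a list of words, is placed in array \<open>i\<close> and its length
  in register \<open>i\<close>; everything else is zero.  The result is read from array \<open>0\<close>, its length
  from register \<open>0\<close>.
\<close>

definition init_state :: "nat list list \<Rightarrow> state" where
  "init_state args = \<lparr>
     reg = (\<lambda>i. if 1 \<le> i \<and> i \<le> length args then length (args ! (i - 1)) else 0),
     arr = (\<lambda>i j. if 1 \<le> i \<and> i \<le> length args \<and> j < length (args ! (i - 1))
                   then args ! (i - 1) ! j else 0)\<rparr>"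

definition result :: "state \<Rightarrow> nat list" where
  "result s = map (arr s 0) [0..<reg s 0]"

definition computes_within :: "com \<Rightarrow> nat list list \<Rightarrow> nat list \<Rightarrow> nat \<Rightarrow> bool" where
  "computes_within c args out T \<longleftrightarrow>
     (\<exists>t s. exec c (init_state args) t s \<and> result s = out \<and> t \<le> T)"

text \<open>
  \<open>D\<close> is the set of admissible arguments of \<open>f\<close>, and \<open>sz\<close> is the size measure that
  the running time is compared with.
\<close>

definition poly_time_on ::
  "'a set \<Rightarrow> ('a \<Rightarrow> nat list list) \<Rightarrow> ('b \<Rightarrow> nat list) \<Rightarrow> ('a \<Rightarrow> nat) \<Rightarrow> ('a \<Rightarrow> 'b) \<Rightarrow> bool"
where
  "poly_time_on D enc_in enc_out sz f \<longleftrightarrow>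
     (\<exists>c (p :: nat poly). \<forall>a \<in> D.
        computes_within c (enc_in a) (enc_out (f a)) (poly p (sz a)))"

definition linear_time_on ::
  "'a set \<Rightarrow> ('a \<Rightarrow> nat list list) \<Rightarrow> ('b \<Rightarrow> nat list) \<Rightarrow> ('a \<Rightarrow> nat) \<Rightarrow> ('a \<Rightarrow> 'b) \<Rightarrow> bool"
where
  "linear_time_on D enc_in enc_out sz f \<longleftrightarrow>
     (\<exists>c k l. \<forall>a \<in> D.
        computes_within c (enc_in a) (enc_out (f a)) (k * sz a + l))"


section \<open>Encodings as lists of words\<close>

text \<open>
  The encoding of a well-formed circuit has length linear in its size, and apart from the
  operation codes of the gates its entries are bounded by the size.
\<close>

fun encode_gate :: "gate \<Rightarrow> nat list" where
  "encode_gate (ConstG b) = [0, of_bool b, 0]"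
| "encode_gate (NotG i) = [1, i, 0]"
| "encode_gate (AndG i j) = [2, i, j]"
| "encode_gate (OrG i j) = [3, i, j]"

definition encode_circuit :: "circuit \<Rightarrow> nat list" where
  "encode_circuit C =
     [inputs C, length (gates C), length (outputs C)] @
     concat (map encode_gate (gates C)) @ outputs C"

definition encode_instance :: "line_instance \<Rightarrow> nat list" where
  "encode_instance I =
     encode_circuit (circuit_S I) @ encode_circuit (circuit_P I) @ encode_circuit (circuit_V I)"

definition encode_bits :: "bool list \<Rightarrow> nat list" where
  "encode_bits bs = map of_bool bs"

end

theory Submission
  imports Defs
begin

text \<open>
  Each edge \<open>x \<rightarrow> S x\<close> of the given line is subdivided into unit steps. The new vertices are pairs
  \<open>(x, q)\<close>, where \<open>q\<close> runs from a value \<open>low x\<close>, essentially twice the potential of \<open>x\<close>, to the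
  corresponding value of \<open>S x\<close>, exclusively; the meter of such a vertex is \<open>q + 1\<close>, all other pairs
  are isolated with meter \<open>0\<close>. Whether \<open>(x, q)\<close> is on the line is decided from \<open>S x\<close>, \<open>P x\<close> and the
  potentials of \<open>x\<close> and \<open>S x\<close> alone, in such a way that a violation at \<open>(x, q)\<close> can only be caused by
  a violation at \<open>x\<close> itself. Solutions are therefore mapped back by the projection
  \<open>(x, q) \<mapsto> x\<close>, which takes linear time without evaluating any circuit. The new circuits consist of
  shifted copies of the given ones and of rows of small formulas at addresses linear in the
  parameters of the instance. They are printed by a program with nested loops whose limits are
  computed from the input only, so that its running time is polynomial.
\<close>

section \<open>A loop language without assignment\<close>

text \<open>The meter must rise by exactly 1 while the potential may jump, which forces the
  intermediate vertices. The difficulty is blame: the projection can only return \<open>x\<close>,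
  so nothing may go wrong at \<open>(x, q)\<close> because of a defect of \<open>P x\<close> or
  \<open>S x\<close>. For instance, a vertex of potential 0 that has a predecessor is a defect of
  that predecessor; its own meter must still differ from 1, and the additional bit of
  \<open>low\<close> sees to that. Likewise both ends of a subdivided edge count as active whatever
  the potentials are, so that a sound vertex always finds active neighbours. The shape of the
  circuits is dictated by \<open>poly_time_on\<close>: a machine that can only increment and
  decrement has to print the encoding word for word, so every wire needs an address in closed form.
  Hence rows of formulas with equal gate counts; the factors 3, 4, 8, 10, 11 and 23 in the layout
  are these counts.\<close>

datatype expr = Num nat | Var nat | Arr nat expr | Plus expr expr

datatype stmt =
    Emit expr
  | Bind expr stmt
  | For expr stmt
  | IfLess expr expr stmt stmt
  | Then stmt stmt

fun val :: "(nat \<Rightarrow> nat \<Rightarrow> nat) \<Rightarrow> (nat \<Rightarrow> nat) \<Rightarrow> expr \<Rightarrow> nat" where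
  "val h \<rho> (Num k) = k"
| "val h \<rho> (Var v) = \<rho> v"
| "val h \<rho> (Arr a e) = h a (val h \<rho> e)"
| "val h \<rho> (Plus e f) = val h \<rho> e + val h \<rho> f"

text \<open>
  \<open>Var v\<close> is register \<open>v\<close>, and \<open>d\<close> is the first free register: \<open>Bind\<close> stores its value in
  register \<open>d\<close>, \<open>For\<close> stores its limit in register \<open>d\<close> and its index in register \<open>d + 1\<close>.
  There is no assignment, so values cannot grow from one iteration to the next; this is why every
  statement runs in polynomial time.
\<close>

fun emitted :: "(nat \<Rightarrow> nat \<Rightarrow> nat) \<Rightarrow> stmt \<Rightarrow> nat \<Rightarrow> (nat \<Rightarrow> nat) \<Rightarrow> nat list" where
  "emitted h (Emit e) d \<rho> = [val h \<rho> e]"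
| "emitted h (Bind e p) d \<rho> = emitted h p (d + 1) (\<rho>(d := val h \<rho> e))"
| "emitted h (For e p) d \<rho> =
     concat (map (\<lambda>i. emitted h p (d + 2) (\<rho>(d := val h \<rho> e, d + 1 := i))) [0..<val h \<rho> e])"
| "emitted h (IfLess e f p q) d \<rho> =
     (if val h \<rho> e < val h \<rho> f then emitted h p d \<rho> else emitted h q d \<rho>)"
| "emitted h (Then p q) d \<rho> = emitted h p d \<rho> @ emitted h q d \<rho>"

text \<open>Register 0 and array 0 receive the output. Barring them from expressions makes values
  independent of what has already been emitted.\<close>

fun expr_ok :: "nat \<Rightarrow> expr \<Rightarrow> bool" where
  "expr_ok d (Num k) \<longleftrightarrow> True"
| "expr_ok d (Var v) \<longleftrightarrow> 0 < v \<and> v < d"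
| "expr_ok d (Arr a e) \<longleftrightarrow> 0 < a \<and> expr_ok d e"
| "expr_ok d (Plus e f) \<longleftrightarrow> expr_ok d e \<and> expr_ok d f"

fun stmt_ok :: "nat \<Rightarrow> stmt \<Rightarrow> bool" where
  "stmt_ok d (Emit e) \<longleftrightarrow> expr_ok d e"
| "stmt_ok d (Bind e p) \<longleftrightarrow> expr_ok d e \<and> stmt_ok (d + 1) p"
| "stmt_ok d (For e p) \<longleftrightarrow> expr_ok d e \<and> stmt_ok (d + 2) p"
| "stmt_ok d (IfLess e f p q) \<longleftrightarrow> expr_ok d e \<and> expr_ok d f \<and> stmt_ok d p \<and> stmt_ok d q"
| "stmt_ok d (Then p q) \<longleftrightarrow> stmt_ok d p \<and> stmt_ok d q"

fun compile_expr :: "nat \<Rightarrow> expr \<Rightarrow> com" where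
  "compile_expr d (Num k) = Const d k"
| "compile_expr d (Var v) = Copy d v"
| "compile_expr d (Arr a e) = Seq (compile_expr d e) (Load d a d)"
| "compile_expr d (Plus e f) =
     Seq (compile_expr d e) (Seq (compile_expr (d + 1) f)
       (Seq (Const (d + 2) 0) (Loop (Less (d + 2) (d + 1)) (Seq (Inc d) (Dec (d + 1))))))"

fun compile :: "nat \<Rightarrow> stmt \<Rightarrow> com" where
  "compile d (Emit e) = Seq (compile_expr d e) (Seq (Store 0 0 d) (Inc 0))"
| "compile d (Bind e p) = Seq (compile_expr d e) (compile (d + 1) p)"
| "compile d (For e p) =
     Seq (compile_expr d e) (Seq (Const (d + 1) 0)
       (Loop (Less (d + 1) d) (Seq (compile (d + 2) p) (Inc (d + 1)))))"
| "compile d (IfLess e f p q) =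
     Seq (compile_expr d e) (Seq (compile_expr (d + 1) f)
       (Cond (Less d (d + 1)) (compile d p) (compile d q)))"
| "compile d (Then p q) = Seq (compile d p) (compile d q)"

text \<open>Exact step counts. The machine cannot add, so a sum pays three steps per unit moved
  (\<open>Inc\<close>, \<open>Dec\<close>, loop test), one step to clear the reference register
  \<open>d + 2\<close>, and one for the failing test.\<close>

fun expr_cost :: "(nat \<Rightarrow> nat \<Rightarrow> nat) \<Rightarrow> (nat \<Rightarrow> nat) \<Rightarrow> expr \<Rightarrow> nat" where
  "expr_cost h \<rho> (Num k) = 1"
| "expr_cost h \<rho> (Var v) = 1"
| "expr_cost h \<rho> (Arr a e) = expr_cost h \<rho> e + 1"
| "expr_cost h \<rho> (Plus e f) = expr_cost h \<rho> e + expr_cost h \<rho> f + 3 * val h \<rho> f + 2"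

fun cost :: "(nat \<Rightarrow> nat \<Rightarrow> nat) \<Rightarrow> stmt \<Rightarrow> nat \<Rightarrow> (nat \<Rightarrow> nat) \<Rightarrow> nat" where
  "cost h (Emit e) d \<rho> = expr_cost h \<rho> e + 2"
| "cost h (Bind e p) d \<rho> = expr_cost h \<rho> e + cost h p (d + 1) (\<rho>(d := val h \<rho> e))"
| "cost h (For e p) d \<rho> = expr_cost h \<rho> e + 2 +
     (\<Sum>i<val h \<rho> e. cost h p (d + 2) (\<rho>(d := val h \<rho> e, d + 1 := i)) + 2)"
| "cost h (IfLess e f p q) d \<rho> = expr_cost h \<rho> e + expr_cost h \<rho> f + 1 +
     (if val h \<rho> e < val h \<rho> f then cost h p d \<rho> else cost h q d \<rho>)"
| "cost h (Then p q) d \<rho> = cost h p d \<rho> + cost h q d \<rho>"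

text \<open>The output cells are left out because emission changes them; registers from
  \<open>d\<close> on are scratch space that a statement may overwrite.\<close>

definition matches :: "nat \<Rightarrow> state \<Rightarrow> (nat \<Rightarrow> nat \<Rightarrow> nat) \<Rightarrow> (nat \<Rightarrow> nat) \<Rightarrow> bool" where
  "matches d s h \<rho> \<longleftrightarrow> (\<forall>r. 0 < r \<and> r < d \<longrightarrow> reg s r = \<rho> r) \<and> (\<forall>a. 0 < a \<longrightarrow> arr s a = h a)"

section \<open>Correctness of the compiler, with exact step counts\<close>

lemma exec_add_loop:
  assumes "reg s z = 0" "z \<noteq> x" "z \<noteq> y" "x \<noteq> y"
  shows "exec (Loop (Less z y) (Seq (Inc x) (Dec y))) s (3 * reg s y + 1)
    (s\<lparr>reg := (reg s)(x := reg s x + reg s y, y := 0)\<rparr>)"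
  using assms
proof (induction "reg s y" arbitrary: s)
  case 0
  then have "s\<lparr>reg := (reg s)(x := reg s x + reg s y, y := 0)\<rparr> = s"
    by (cases s) (auto simp: fun_eq_iff)
  moreover have "exec (Loop (Less z y) (Seq (Inc x) (Dec y))) s 1 s"
    using 0 by (intro exec.LoopFalse) simp
  ultimately show ?case using 0 by (metis add_0 mult_0_right)
next
  case (Suc k)
  define s' where "s' = set_reg y (reg s y - 1) (set_reg x (reg s x + 1) s)"
  have "exec (Seq (Inc x) (Dec y)) s (1 + 1)
      (set_reg y (reg (set_reg x (reg s x + 1) s) y - 1) (set_reg x (reg s x + 1) s))"
    by (rule exec.Seq[OF exec.Inc exec.Dec])
  then have step: "exec (Seq (Inc x) (Dec y)) s 2 s'"
    using Suc.prems by (simp add: s'_def set_reg_def numeral_2_eq_2)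
  have k: "k = reg s' y" "reg s' z = 0"
    using Suc by (auto simp: s'_def set_reg_def)
  have "exec (Loop (Less z y) (Seq (Inc x) (Dec y))) s' (3 * reg s' y + 1)
    (s'\<lparr>reg := (reg s')(x := reg s' x + reg s' y, y := 0)\<rparr>)"
    by (rule Suc.hyps(1)[OF k Suc.prems(2-4)])
  moreover have "s'\<lparr>reg := (reg s')(x := reg s' x + reg s' y, y := 0)\<rparr> =
      s\<lparr>reg := (reg s)(x := reg s x + reg s y, y := 0)\<rparr>"
    using Suc by (auto simp: s'_def set_reg_def fun_eq_iff)
  moreover have "2 + (3 * reg s' y + 1) + 1 = 3 * reg s y + 1"
    using Suc k by simp
  moreover have "holds (Less z y) s"
    using Suc by simp
  ultimately show ?case
    using exec.LoopTrue[OF _ step] by metis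
qed

text \<open>The bound \<open>c\<close> on readable registers is kept apart from the first scratch
  register \<open>d\<close>, because the second operand of a sum is evaluated above the value of the
  first.\<close>

lemma exec_compile_expr:
  assumes "expr_ok c e" "c \<le> d" "matches c s h \<rho>"
  shows "\<exists>s'. exec (compile_expr d e) s (expr_cost h \<rho> e) s' \<and>
    reg s' d = val h \<rho> e \<and> (\<forall>r<d. reg s' r = reg s r) \<and> arr s' = arr s"
  using assms
proof (induction e arbitrary: d s)
  case (Num k)
  then show ?case
    using exec.Const[where x = d and k = k and s = s] by (intro exI[of _ "set_reg d k s"]) (auto simp: set_reg_def)
next
  case (Var v)
  then show ?case
    using exec.Copy[where x = d and y = v and s = s]
    by (intro exI[of _ "set_reg d (reg s v) s"]) (auto simp: set_reg_def matches_def)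
next
  case (Arr a e)
  then obtain s1 where s1: "exec (compile_expr d e) s (expr_cost h \<rho> e) s1"
    "reg s1 d = val h \<rho> e" "\<forall>r<d. reg s1 r = reg s r" "arr s1 = arr s"
    by fastforce
  from exec.Seq[OF s1(1) exec.Load, of d a d] s1 Arr.prems show ?case
    by (intro exI[of _ "set_reg d (arr s1 a (reg s1 d)) s1"]) (auto simp: set_reg_def matches_def)
next
  case (Plus e f)
  from Plus.IH(1)[of d s] Plus.prems obtain s1 where s1: "exec (compile_expr d e) s (expr_cost h \<rho> e) s1"
    "reg s1 d = val h \<rho> e" "\<forall>r<d. reg s1 r = reg s r" "arr s1 = arr s"
    by auto
  have "matches c s1 h \<rho>"
    using s1 Plus.prems by (auto simp: matches_def)
  with Plus.IH(2)[of "d + 1" s1] Plus.prems obtain s2 where s2: "exec (compile_expr (d + 1) f) s1 (expr_cost h \<rho> f) s2"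
    "reg s2 (d + 1) = val h \<rho> f" "\<forall>r<d + 1. reg s2 r = reg s1 r" "arr s2 = arr s1"
    by auto
  define s3 where "s3 = set_reg (d + 2) 0 s2"
  have s3: "exec (Const (d + 2) 0) s2 1 s3"
    unfolding s3_def by (rule exec.Const)
  have s4: "exec (Loop (Less (d + 2) (d + 1)) (Seq (Inc d) (Dec (d + 1)))) s3
    (3 * reg s3 (d + 1) + 1) (s3\<lparr>reg := (reg s3)(d := reg s3 d + reg s3 (d + 1), d + 1 := 0)\<rparr>)"
    by (rule exec_add_loop) (auto simp: s3_def set_reg_def)
  have "reg s3 (d + 1) = val h \<rho> f" "reg s3 d = val h \<rho> e"
    using s1 s2 by (auto simp: s3_def set_reg_def)
  with exec.Seq[OF s1(1) exec.Seq[OF s2(1) exec.Seq[OF s3 s4]]] show ?case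
    using s1 s2
    by (intro exI[of _ "s3\<lparr>reg := (reg s3)(d := reg s3 d + reg s3 (d + 1), d + 1 := 0)\<rparr>"])
      (auto simp: s3_def set_reg_def add_ac)
qed

lemma result_append:
  assumes "reg s' 0 = reg s 0 + 1" "arr s' 0 = (arr s 0)(reg s 0 := v)"
  shows "result s' = result s @ [v]"
  using assms by (auto simp: result_def)

text \<open>The start index is arbitrary so that the induction can run on the number
  \<open>N - i\<close> of remaining rounds. Limit and index lie below the first scratch register
  \<open>d + 2\<close> of the body, which therefore returns them intact.\<close>

lemma exec_for_loop:
  assumes body: "\<And>i s. i < N \<Longrightarrow> matches (d + 2) s h (\<rho>(d := N, d + 1 := i)) \<Longrightarrow>
      \<exists>s'. exec c s (f i) s' \<and> matches (d + 2) s' h (\<rho>(d := N, d + 1 := i)) \<and>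
        result s' = result s @ g i"
    and "i \<le> N" "matches (d + 2) s h (\<rho>(d := N, d + 1 := i))" "0 < d"
  shows "\<exists>s'. exec (Loop (Less (d + 1) d) (Seq c (Inc (d + 1)))) s ((\<Sum>j=i..<N. f j + 2) + 1) s' \<and>
    matches d s' h \<rho> \<and> result s' = result s @ concat (map g [i..<N])"
  using assms(2,3)
proof (induction "N - i" arbitrary: i s)
  case 0
  then have "\<not> holds (Less (d + 1) d) s"
    using \<open>0 < d\<close> by (auto simp: matches_def)
  from exec.LoopFalse[OF this] 0 show ?case
    by (intro exI[of _ s]) (auto simp: matches_def)
next
  case (Suc k)
  then have i: "i < N" by simp
  obtain s1 where s1: "exec c s (f i) s1" "matches (d + 2) s1 h (\<rho>(d := N, d + 1 := i))"
    "result s1 = result s @ g i"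
    using body[OF i Suc.prems(2)] by blast
  define s2 where "s2 = set_reg (d + 1) (reg s1 (d + 1) + 1) s1"
  have s2: "exec (Seq c (Inc (d + 1))) s (f i + 1) s2"
    unfolding s2_def by (rule exec.Seq[OF s1(1) exec.Inc])
  have m2: "matches (d + 2) s2 h (\<rho>(d := N, d + 1 := Suc i))" and r2: "result s2 = result s1"
    using s1(2) by (auto simp: s2_def set_reg_def matches_def result_def)
  have "k = N - Suc i" "Suc i \<le> N" using Suc.hyps(2) i by auto
  from Suc.hyps(1)[OF this m2] obtain s3 where
    s3: "exec (Loop (Less (d + 1) d) (Seq c (Inc (d + 1)))) s2 ((\<Sum>j=Suc i..<N. f j + 2) + 1) s3"
    "matches d s3 h \<rho>" "result s3 = result s2 @ concat (map g [Suc i..<N])"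
    by blast
  have holds: "holds (Less (d + 1) d) s"
    using Suc.prems(2) i \<open>0 < d\<close> by (auto simp: matches_def)
  have "f i + 1 + ((\<Sum>j=Suc i..<N. f j + 2) + 1) + 1 = (\<Sum>j=i..<N. f j + 2) + 1"
    using i by (simp add: sum.atLeast_Suc_lessThan)
  with exec.LoopTrue[OF holds s2 s3(1)]
  have "exec (Loop (Less (d + 1) d) (Seq c (Inc (d + 1)))) s ((\<Sum>j=i..<N. f j + 2) + 1) s3"
    by metis
  with s3 s1 r2 i show ?case
    by (intro exI[of _ s3]) (auto simp: upt_conv_Cons)
qed

lemma exec_compile:
  assumes "stmt_ok d p" "0 < d" "matches d s h \<rho>"
  shows "\<exists>s'. exec (compile d p) s (cost h p d \<rho>) s' \<and> matches d s' h \<rho> \<and>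
    result s' = result s @ emitted h p d \<rho>"
  using assms
proof (induction p arbitrary: d s \<rho>)
  case (Emit e)
  from exec_compile_expr[of d e d s h \<rho>] Emit obtain s1 where
    s1: "exec (compile_expr d e) s (expr_cost h \<rho> e) s1"
    "reg s1 d = val h \<rho> e" "\<forall>r<d. reg s1 r = reg s r" "arr s1 = arr s"
    by auto
  define s2 where "s2 = set_arr 0 (reg s1 0) (reg s1 d) s1"
  define s3 where "s3 = set_reg 0 (reg s2 0 + 1) s2"
  have "exec (Store 0 0 d) s1 1 s2" "exec (Inc 0) s2 1 s3"
    unfolding s2_def s3_def by (rule exec.Store exec.Inc)+
  from exec.Seq[OF s1(1) exec.Seq[OF this]]
  have "exec (compile d (Emit e)) s (cost h (Emit e) d \<rho>) s3"
    by (simp add: numeral_2_eq_2)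
  moreover have "result s3 = result s @ [val h \<rho> e]"
    using s1 \<open>0 < d\<close> by (intro result_append) (auto simp: s3_def s2_def set_reg_def set_arr_def)
  moreover have "matches d s3 h \<rho>"
    using s1 Emit by (auto simp: s3_def s2_def set_reg_def set_arr_def matches_def)
  ultimately show ?case by auto
next
  case (Bind e p)
  from exec_compile_expr[of d e d s h \<rho>] Bind obtain s1 where
    s1: "exec (compile_expr d e) s (expr_cost h \<rho> e) s1"
    "reg s1 d = val h \<rho> e" "\<forall>r<d. reg s1 r = reg s r" "arr s1 = arr s"
    by auto
  have "matches (d + 1) s1 h (\<rho>(d := val h \<rho> e))"
    using s1 Bind.prems by (auto simp: matches_def)
  with Bind obtain s2 where s2:
    "exec (compile (d + 1) p) s1 (cost h p (d + 1) (\<rho>(d := val h \<rho> e))) s2"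
    "matches (d + 1) s2 h (\<rho>(d := val h \<rho> e))"
    "result s2 = result s1 @ emitted h p (d + 1) (\<rho>(d := val h \<rho> e))"
    by (metis add_pos_nonneg stmt_ok.simps(2) zero_le)
  from exec.Seq[OF s1(1) s2(1)] s2 s1 \<open>0 < d\<close> show ?case
    by (intro exI[of _ s2]) (auto simp: matches_def result_def)
next
  case (For e p)
  from exec_compile_expr[of d e d s h \<rho>] For obtain s1 where
    s1: "exec (compile_expr d e) s (expr_cost h \<rho> e) s1"
    "reg s1 d = val h \<rho> e" "\<forall>r<d. reg s1 r = reg s r" "arr s1 = arr s"
    by auto
  let ?N = "val h \<rho> e"
  define s2 where "s2 = set_reg (d + 1) 0 s1"
  have s2: "exec (Const (d + 1) 0) s1 1 s2"
    unfolding s2_def by (rule exec.Const)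
  have m2: "matches (d + 2) s2 h (\<rho>(d := ?N, d + 1 := 0))" "result s2 = result s"
    using s1 For.prems by (auto simp: s2_def matches_def set_reg_def result_def less_Suc_eq)
  have "\<exists>s3. exec (Loop (Less (d + 1) d) (Seq (compile (d + 2) p) (Inc (d + 1)))) s2
      ((\<Sum>i=0..<?N. cost h p (d + 2) (\<rho>(d := ?N, d + 1 := i)) + 2) + 1) s3 \<and>
    matches d s3 h \<rho> \<and>
    result s3 = result s2 @ concat (map (\<lambda>i. emitted h p (d + 2) (\<rho>(d := ?N, d + 1 := i))) [0..<?N])"
    by (rule exec_for_loop) (use For m2 in auto)
  then obtain s3 where
    s3: "exec (Loop (Less (d + 1) d) (Seq (compile (d + 2) p) (Inc (d + 1)))) s2
      ((\<Sum>i=0..<?N. cost h p (d + 2) (\<rho>(d := ?N, d + 1 := i)) + 2) + 1) s3"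
    "matches d s3 h \<rho>"
    "result s3 = result s2 @ concat (map (\<lambda>i. emitted h p (d + 2) (\<rho>(d := ?N, d + 1 := i))) [0..<?N])"
    by blast
  from exec.Seq[OF s1(1) exec.Seq[OF s2 s3(1)]] s3(2,3) m2(2) show ?case
    by (intro exI[of _ s3]) (auto simp: atLeast0LessThan add_ac)
next
  case (IfLess e f p q)
  from exec_compile_expr[of d e d s h \<rho>] IfLess obtain s1 where
    s1: "exec (compile_expr d e) s (expr_cost h \<rho> e) s1"
    "reg s1 d = val h \<rho> e" "\<forall>r<d. reg s1 r = reg s r" "arr s1 = arr s"
    by auto
  have "matches d s1 h \<rho>"
    using s1 IfLess.prems by (auto simp: matches_def)
  with exec_compile_expr[of d f "d + 1" s1 h \<rho>] IfLess.prems obtain s2 where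
    s2: "exec (compile_expr (d + 1) f) s1 (expr_cost h \<rho> f) s2"
    "reg s2 (d + 1) = val h \<rho> f" "\<forall>r<d + 1. reg s2 r = reg s1 r" "arr s2 = arr s1"
    by auto
  have m2: "matches d s2 h \<rho>" "result s2 = result s"
    using s1 s2 IfLess.prems by (auto simp: matches_def result_def)
  have h2: "holds (Less d (d + 1)) s2 \<longleftrightarrow> val h \<rho> e < val h \<rho> f"
    using s1 s2 by simp
  show ?case
  proof (cases "val h \<rho> e < val h \<rho> f")
    case True
    with IfLess m2 obtain s3 where s3: "exec (compile d p) s2 (cost h p d \<rho>) s3"
      "matches d s3 h \<rho>" "result s3 = result s2 @ emitted h p d \<rho>"
      by (metis stmt_ok.simps(4))
    from exec.Seq[OF s1(1) exec.Seq[OF s2(1) exec.CondTrue[OF _ s3(1)]]] s3(2,3) m2(2) True h2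
    show ?thesis by (intro exI[of _ s3]) (auto simp: add_ac)
  next
    case False
    with IfLess m2 obtain s3 where s3: "exec (compile d q) s2 (cost h q d \<rho>) s3"
      "matches d s3 h \<rho>" "result s3 = result s2 @ emitted h q d \<rho>"
      by (metis stmt_ok.simps(4))
    from exec.Seq[OF s1(1) exec.Seq[OF s2(1) exec.CondFalse[OF _ s3(1)]]] s3(2,3) m2(2) False h2
    show ?thesis by (intro exI[of _ s3]) (auto simp: add_ac)
  qed
next
  case (Then p q)
  from Then obtain s1 where s1: "exec (compile d p) s (cost h p d \<rho>) s1"
    "matches d s1 h \<rho>" "result s1 = result s @ emitted h p d \<rho>"
    by (metis stmt_ok.simps(5))
  from Then s1 obtain s2 where s2: "exec (compile d q) s1 (cost h q d \<rho>) s2"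
    "matches d s2 h \<rho>" "result s2 = result s1 @ emitted h q d \<rho>"
    by (metis stmt_ok.simps(5))
  from exec.Seq[OF s1(1) s2(1)] s1 s2 show ?case
    by auto
qed

section \<open>Polynomial bounds on running times\<close>

definition bounded_by :: "nat \<Rightarrow> (nat \<Rightarrow> nat \<Rightarrow> nat) \<Rightarrow> (nat \<Rightarrow> nat) \<Rightarrow> nat \<Rightarrow> bool" where
  "bounded_by d h \<rho> B \<longleftrightarrow> (\<forall>r. 0 < r \<and> r < d \<longrightarrow> \<rho> r \<le> B) \<and> (\<forall>a i. 0 < a \<longrightarrow> h a i \<le> B)"

lemma bounded_by_update:
  "bounded_by d h \<rho> B \<Longrightarrow> v \<le> C \<Longrightarrow> bounded_by (Suc d) h (\<rho>(d := v)) (B + C)"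
  by (auto simp: bounded_by_def less_Suc_eq intro: trans_le_add1)

text \<open>Since \<open>B\<close> bounds the input cells at all indices, reading an array leads
  back to \<open>B\<close> however large the index is; only sums make values grow.\<close>

lemma expr_poly_bound:
  "expr_ok d e \<Longrightarrow> \<exists>q. \<forall>h \<rho> B. bounded_by d h \<rho> B \<longrightarrow>
    val h \<rho> e \<le> poly q B \<and> expr_cost h \<rho> e \<le> poly q B"
proof (induction e)
  case (Num k)
  show ?case by (intro exI[of _ "[:k + 1:]"]) auto
next
  case (Var v)
  then show ?case by (intro exI[of _ "[:1, 1:]"]) (auto simp: bounded_by_def le_SucI)
next
  case (Arr a e)
  then obtain q where q: "\<And>h \<rho> B. bounded_by d h \<rho> B \<Longrightarrow> expr_cost h \<rho> e \<le> poly q B"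
    by auto
  show ?case
  proof (intro exI[of _ "q + [:1, 1:]"] allI impI)
    fix h \<rho> B
    assume B: "bounded_by d h \<rho> B"
    then have "h a (val h \<rho> e) \<le> B"
      using Arr.prems by (auto simp: bounded_by_def)
    with q[OF B] show "val h \<rho> (Arr a e) \<le> poly (q + [:1, 1:]) B \<and>
        expr_cost h \<rho> (Arr a e) \<le> poly (q + [:1, 1:]) B"
      by simp
  qed
next
  case (Plus e f)
  then obtain q where q: "\<And>h \<rho> B. bounded_by d h \<rho> B \<Longrightarrow>
    val h \<rho> e \<le> poly q B \<and> expr_cost h \<rho> e \<le> poly q B" by auto
  from Plus obtain r where r: "\<And>h \<rho> B. bounded_by d h \<rho> B \<Longrightarrow>
    val h \<rho> f \<le> poly r B \<and> expr_cost h \<rho> f \<le> poly r B" by auto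
  show ?case
  \<comment> \<open>The factor 4 pays for evaluating \<open>f\<close> once and for three steps per
    unit of its value.\<close>
  proof (intro exI[of _ "q + smult 4 r + [:2:]"] allI impI)
    fix h \<rho> B
    assume "bounded_by d h \<rho> B"
    from q[OF this] r[OF this]
    show "val h \<rho> (Plus e f) \<le> poly (q + smult 4 r + [:2:]) B \<and>
      expr_cost h \<rho> (Plus e f) \<le> poly (q + smult 4 r + [:2:]) B"
      by auto
  qed
qed

text \<open>Each value bound on entering a scope is at most \<open>q B\<close> for some polynomial
  \<open>q\<close> and raises the bound by that much. The nesting depth is that of the program text,
  so finitely many compositions of polynomials suffice.\<close>

lemma cost_poly_bound:
  "stmt_ok d p \<Longrightarrow> \<exists>q. \<forall>h \<rho> B. bounded_by d h \<rho> B \<longrightarrow> cost h p d \<rho> \<le> poly q B"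
proof (induction p arbitrary: d)
  case (Emit e)
  then obtain q where "\<And>h \<rho> B. bounded_by d h \<rho> B \<Longrightarrow> expr_cost h \<rho> e \<le> poly q B"
    using expr_poly_bound[of d e] unfolding stmt_ok.simps by blast
  then show ?case by (intro exI[of _ "q + [:2:]"]) auto
next
  case (Bind e p)
  then obtain q where q: "\<And>h \<rho> B. bounded_by d h \<rho> B \<Longrightarrow>
    val h \<rho> e \<le> poly q B \<and> expr_cost h \<rho> e \<le> poly q B"
    using expr_poly_bound[of d e] unfolding stmt_ok.simps by blast
  from Bind obtain r where r: "\<And>h \<rho> B. bounded_by (d + 1) h \<rho> B \<Longrightarrow> cost h p (d + 1) \<rho> \<le> poly r B"
    unfolding stmt_ok.simps by blast
  show ?case
  proof (intro exI[of _ "q + pcompose r ([:0, 1:] + q)"] allI impI)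
    fix h \<rho> B
    assume B: "bounded_by d h \<rho> B"
    have "cost h p (d + 1) (\<rho>(d := val h \<rho> e)) \<le> poly r (B + poly q B)"
      using bounded_by_update[OF B] q[OF B] by (intro r) simp
    with q[OF B] show "cost h (Bind e p) d \<rho> \<le> poly (q + pcompose r ([:0, 1:] + q)) B"
      by (simp add: poly_pcompose)
  qed
next
  case (For e p)
  then obtain q where q: "\<And>h \<rho> B. bounded_by d h \<rho> B \<Longrightarrow>
    val h \<rho> e \<le> poly q B \<and> expr_cost h \<rho> e \<le> poly q B"
    using expr_poly_bound[of d e] unfolding stmt_ok.simps by blast
  from For obtain r where r: "\<And>h \<rho> B. bounded_by (d + 2) h \<rho> B \<Longrightarrow> cost h p (d + 2) \<rho> \<le> poly r B"
    unfolding stmt_ok.simps by blast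
  show ?case
  \<comment> \<open>Limit and index are both new in the body, each at most \<open>q B\<close>, which
    gives the doubled \<open>q\<close> inside the composition. There are at most \<open>q B\<close>
    rounds, each with 2 additional steps for increment and test.\<close>
  proof (intro exI[of _ "q + [:2:] + q * (pcompose r ([:0, 1:] + q + q) + [:2:])"] allI impI)
    fix h \<rho> B
    assume B: "bounded_by d h \<rho> B"
    let ?N = "val h \<rho> e"
    have "cost h p (d + 2) (\<rho>(d := ?N, d + 1 := i)) \<le> poly r (B + poly q B + poly q B)"
      if "i < ?N" for i
      using bounded_by_update[OF bounded_by_update[OF B], of ?N "poly q B" i "poly q B"] q[OF B] that
      by (intro r) simp
    then have "(\<Sum>i<?N. cost h p (d + 2) (\<rho>(d := ?N, d + 1 := i)) + 2) \<le>
        ?N * (poly r (B + poly q B + poly q B) + 2)"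
      using sum_bounded_above[of "{..<?N}" "\<lambda>i. cost h p (d + 2) (\<rho>(d := ?N, d + 1 := i)) + 2"
          "poly r (B + poly q B + poly q B) + 2"] by simp
    also have "\<dots> \<le> poly q B * (poly r (B + poly q B + poly q B) + 2)"
      using q[OF B] by (intro mult_right_mono) auto
    finally show "cost h (For e p) d \<rho> \<le>
        poly (q + [:2:] + q * (pcompose r ([:0, 1:] + q + q) + [:2:])) B"
      using q[OF B] by (simp add: poly_pcompose)
  qed
next
  case (IfLess e f p1 p2)
  then obtain q where q: "\<And>h \<rho> B. bounded_by d h \<rho> B \<Longrightarrow> expr_cost h \<rho> e \<le> poly q B"
    using expr_poly_bound[of d e] unfolding stmt_ok.simps by blast
  from IfLess obtain r where r: "\<And>h \<rho> B. bounded_by d h \<rho> B \<Longrightarrow> expr_cost h \<rho> f \<le> poly r B"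
    using expr_poly_bound[of d f] unfolding stmt_ok.simps by blast
  from IfLess obtain u where u: "\<And>h \<rho> B. bounded_by d h \<rho> B \<Longrightarrow> cost h p1 d \<rho> \<le> poly u B"
    unfolding stmt_ok.simps by blast
  from IfLess obtain v where v: "\<And>h \<rho> B. bounded_by d h \<rho> B \<Longrightarrow> cost h p2 d \<rho> \<le> poly v B"
    unfolding stmt_ok.simps by blast
  show ?case
  proof (intro exI[of _ "q + r + u + v + [:1:]"] allI impI)
    fix h \<rho> B
    assume "bounded_by d h \<rho> B"
    from q[OF this] r[OF this] u[OF this] v[OF this]
    show "cost h (IfLess e f p1 p2) d \<rho> \<le> poly (q + r + u + v + [:1:]) B"
      by auto
  qed
next
  case (Then p1 p2)
  then obtain u where u: "\<And>h \<rho> B. bounded_by d h \<rho> B \<Longrightarrow> cost h p1 d \<rho> \<le> poly u B"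
    unfolding stmt_ok.simps by blast
  from Then obtain v where v: "\<And>h \<rho> B. bounded_by d h \<rho> B \<Longrightarrow> cost h p2 d \<rho> \<le> poly v B"
    unfolding stmt_ok.simps by blast
  show ?case
    using u v by (intro exI[of _ "u + v"]) (auto simp: add_mono)
qed


section \<open>Subdividing a line with increasing potential\<close>

locale potential_line =
  fixes S P :: "'a \<Rightarrow> 'a" and V :: "'a \<Rightarrow> nat" and z :: 'a and m :: nat
  assumes V_less: "V x < 2 ^ m"
    and origin: "P z = z" "S z \<noteq> z" "V z = 0"
begin

text \<open>
  Doubling the potential leaves room to give every non-origin vertex of the line a positive value
  \<open>low x\<close>. If \<open>x\<close> is no solution and \<open>S x \<noteq> x\<close>, then \<open>high x = low (S x)\<close>; but \<open>high x\<close> takes the last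
  bit to be \<open>1\<close> instead of testing \<open>P (S x) \<noteq> S x\<close>, so that a defect of \<open>S x\<close> never shows up at
  a vertex \<open>(x, q)\<close>.
\<close>

definition low :: "'a \<Rightarrow> nat" where
  "low x = 2 * V x + (if P x \<noteq> x then 1 else 0)"

definition high :: "'a \<Rightarrow> nat" where
  "high x = 2 * V (S x) + 1"

text \<open>The two equations keep both ends of the edge active even if the potential fails to
  increase and the interval is empty. A neighbour of a defective \<open>x\<close> then still meets
  an active vertex.\<close>

definition active :: "'a \<Rightarrow> nat \<Rightarrow> bool" where
  "active x q \<longleftrightarrow> \<not> (S x = x \<and> P x = x) \<and>
     (q = low x \<or> q = 2 * V (S x) \<or> low x < q \<and> q < high x)"

text \<open>Overflow and underflow occur only if \<open>x\<close> is a solution.\<close>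

fun step :: "'a \<times> nat \<Rightarrow> 'a \<times> nat" where
  "step (x, q) = (if active x q then if q = 2 * V (S x) then (S x, high x) else (x, (q + 1) mod 2 ^ (m + 1))
     else (x, q))"

fun back_step :: "'a \<times> nat \<Rightarrow> 'a \<times> nat" where
  "back_step (x, q) = (if active x q then if q = low x then (P x, 2 * V x)
       else (x, (q + 2 ^ (m + 1) - 1) mod 2 ^ (m + 1))
     else (x, q))"

fun meter :: "'a \<times> nat \<Rightarrow> nat" where
  "meter (x, q) = (if active x q then q + 1 else 0)"

lemma active_origin: "active z 0"
  by (simp add: active_def low_def origin)

lemma step_origin: "step (z, 0) \<noteq> (z, 0)"
  using origin active_origin by (auto simp: high_def)

lemma back_step_origin: "back_step (z, 0) = (z, 0)"
  using active_origin by (simp add: low_def origin)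

lemma meter_origin: "meter (z, 0) = 1"
  using active_origin by simp

text \<open>Apart from vertices over \<open>x\<close>, only \<open>(S x, high x)\<close> and
  \<open>(P x, 2 * V x)\<close> are visited. Both are active by the equations in
  \<open>active\<close>, whether or not \<open>S x\<close> and \<open>P x\<close> are sound. Meter 1
  means \<open>q = 0\<close>, which lies below \<open>low x\<close> for every sound active
  \<open>x\<close> other than \<open>z\<close>.\<close>

lemma no_violation:
  fixes x :: 'a and q :: nat
  defines "u \<equiv> (x, q)"
  assumes r1: "\<not> (S (P x) \<noteq> x \<and> x \<noteq> z \<or> P (S x) \<noteq> x)"
    and r2: "\<not> (x \<noteq> S x \<and> P (S x) = x \<and> V (S x) \<le> V x)"
  shows "step (back_step u) = u \<or> u = (z, 0)" "back_step (step u) = u"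
    "meter u = 1 \<Longrightarrow> u = (z, 0)"
    "meter u > 0 \<Longrightarrow> meter (step u) = meter u + 1"
    "meter u > 1 \<Longrightarrow> meter u = meter (back_step u) + 1"
proof -
  have all: "(step (back_step u) = u \<or> u = (z, 0)) \<and> back_step (step u) = u \<and>
    (meter u = 1 \<longrightarrow> u = (z, 0)) \<and> (meter u > 0 \<longrightarrow> meter (step u) = meter u + 1) \<and>
    (meter u > 1 \<longrightarrow> meter u = meter (back_step u) + 1)"
  proof (cases "active x q")
    case False
    then show ?thesis by (simp add: u_def)
  next
    case act: True
    have PS: "P (S x) = x" using r1 by simp
    \<comment> \<open>A fixed point of \<open>S\<close> would by \<open>PS\<close> also be fixed by
      \<open>P\<close>, hence isolated and inactive.\<close>
    have Sx: "S x \<noteq> x"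
      using act PS by (auto simp: active_def)
    with r2 PS have lt: "V x < V (S x)"
      by auto
    have q: "low x \<le> q" "q < high x"
      using act lt by (auto simp: active_def low_def high_def)
    have high_le: "high x < 2 ^ (m + 1)"
      using V_less[of "S x"] by (simp add: high_def)
    have act': "active x r" if "low x \<le> r" "r < high x" for r
      using that Sx by (auto simp: active_def low_def high_def)
    have lowS: "low (S x) = high x"
      using PS Sx by (simp add: low_def high_def)
    \<comment> \<open>Active as the lower end of the next edge, even if the potential does not
      increase along it.\<close>
    have actS: "active (S x) (high x)"
      using PS Sx lowS by (auto simp: active_def)
    have bwd: "back_step (step u) = u \<and> meter (step u) = q + 2"
    proof (cases "q = 2 * V (S x)")
      case True
      with act actS lowS PS show ?thesis by (simp add: u_def high_def)
    next
      case False
      with q have q1: "q + 1 < high x" by (simp add: high_def)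
      with high_le have "(q + 1) mod 2 ^ (m + 1) = q + 1" by simp
      moreover have "(q + 1 + 2 ^ (m + 1) - 1) mod 2 ^ (m + 1) = q"
        using q1 high_le by simp
      moreover have "active x (q + 1)" using act' q q1 by simp
      ultimately show ?thesis using act False q by (simp add: u_def)
    qed
    have fwd: "step (back_step u) = u \<and> (meter u > 1 \<longrightarrow> meter (back_step u) = q) \<and> q > 0 \<or> u = (z, 0)"
    proof (cases "q = low x")
      case True
      show ?thesis
      proof (cases "x = z")
        case True
        then show ?thesis using \<open>q = low x\<close> by (simp add: u_def low_def origin)
      next
        case False
        with r1 have SP: "S (P x) = x" by simp
        with Sx have Px: "P x \<noteq> x" by metis
        \<comment> \<open>Active as the upper end of the previous edge, since
          \<open>S (P x) = x\<close>.\<close>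
        then have "active (P x) (2 * V x)"
          using SP by (auto simp: active_def)
        with act True SP Px show ?thesis by (simp add: u_def high_def low_def)
      qed
    next
      case False
      then have q1: "low x \<le> q - 1" "q > 0" "q - 1 < high x" using q by auto
      then have "active x (q - 1)" using act' by simp
      moreover have "(q + 2 ^ (m + 1) - 1) mod 2 ^ (m + 1) = q - 1"
      proof -
        have "q + 2 ^ (m + 1) - 1 = (q - 1) + 2 ^ (m + 1)" using q1 by simp
        moreover have "q - 1 < 2 ^ (m + 1)" using q1 high_le by linarith
        ultimately show ?thesis by (metis mod_add_self2 mod_less)
      qed
      moreover have "q - 1 \<noteq> 2 * V (S x)"
        using q q1 by (auto simp: high_def)
      \<comment> \<open>Stepping forward again from \<open>q - 1\<close> leaves this residue, with
        \<open>2 ^ (m + 1)\<close> in simplified form.\<close>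
      moreover have "q mod (2 * 2 ^ m) = q"
        using q high_le by simp
      ultimately show ?thesis using act False q1 by (simp add: u_def)
    qed
    have "meter u = q + 1" using act by (simp add: u_def)
    moreover have "u = (z, 0) \<longrightarrow> q = 0" by (simp add: u_def)
    ultimately show ?thesis
      using bwd fwd by (auto simp del: step.simps back_step.simps meter.simps)
  qed
  from all show "step (back_step u) = u \<or> u = (z, 0)" "back_step (step u) = u"
    "meter u = 1 \<Longrightarrow> u = (z, 0)"
    "meter u > 0 \<Longrightarrow> meter (step u) = meter u + 1"
    "meter u > 1 \<Longrightarrow> meter u = meter (back_step u) + 1"
    by blast+
qed

end


section \<open>Building circuits\<close>

fun gate_fun :: "(nat \<Rightarrow> bool) \<Rightarrow> gate \<Rightarrow> bool" where
  "gate_fun w (ConstG b) = b"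
| "gate_fun w (NotG i) = (\<not> w i)"
| "gate_fun w (AndG i j) = (w i \<and> w j)"
| "gate_fun w (OrG i j) = (w i \<or> w j)"

text \<open>A gate list is read as a system of equations on one global valuation of the wires.
  Concatenation becomes conjunction, so parts of a circuit can be analysed separately at absolute
  addresses.\<close>

definition sat :: "(nat \<Rightarrow> bool) \<Rightarrow> nat \<Rightarrow> gate list \<Rightarrow> bool" where
  "sat w L gs \<longleftrightarrow> (\<forall>j<length gs. w (L + j) = gate_fun w (gs ! j))"

definition gates_ok :: "nat \<Rightarrow> gate list \<Rightarrow> bool" where
  "gates_ok L gs \<longleftrightarrow> (\<forall>i<length gs. \<forall>j\<in>operands (gs ! i). j < L + i)"

lemma gate_value_eq: "gate_value ws g = gate_fun ((!) ws) g"
  by (cases g) auto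

lemma gate_fun_cong: "(\<And>j. j \<in> operands g \<Longrightarrow> w j = w' j) \<Longrightarrow> gate_fun w g = gate_fun w' g"
  by (cases g) auto

lemma all_less_add: "(\<forall>i<a + (b::nat). Q i) \<longleftrightarrow> (\<forall>i<a. Q i) \<and> (\<forall>i<b. Q (a + i))"
  by (metis add_less_cancel_left le_Suc_ex linorder_not_le trans_less_add1)

lemma sat_append: "sat w L (gs @ hs) \<longleftrightarrow> sat w L gs \<and> sat w (L + length gs) hs"
  by (simp add: sat_def all_less_add nth_append add.assoc)

lemma sat_Nil: "sat w L []"
  by (simp add: sat_def)

lemma sat_Cons: "sat w L (g # gs) \<longleftrightarrow> w L = gate_fun w g \<and> sat w (Suc L) gs"
  using sat_append[of w L "[g]" gs] by (simp add: sat_def)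

lemma gates_ok_append:
  "gates_ok L (gs @ hs) \<longleftrightarrow> gates_ok L gs \<and> gates_ok (L + length gs) hs"
  by (simp add: gates_ok_def all_less_add nth_append add.assoc)

lemma gates_ok_Nil: "gates_ok L []"
  by (simp add: gates_ok_def)

lemma gates_ok_Cons:
  "gates_ok L (g # gs) \<longleftrightarrow> (\<forall>j\<in>operands g. j < L) \<and> gates_ok (Suc L) gs"
  using gates_ok_append[of L "[g]" gs] by (simp add: gates_ok_def)

text \<open>The equations are solvable: gates read only earlier wires, and appending later values
  does not change those.\<close>

lemma foldl_gates_sat:
  assumes "gates_ok (length x) gs"
  shows "length (foldl (\<lambda>ws g. ws @ [gate_value ws g]) x gs) = length x + length gs \<and>
    take (length x) (foldl (\<lambda>ws g. ws @ [gate_value ws g]) x gs) = x \<and>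
    sat ((!) (foldl (\<lambda>ws g. ws @ [gate_value ws g]) x gs)) (length x) gs"
  using assms
proof (induction gs rule: rev_induct)
  case Nil
  then show ?case by (simp add: sat_Nil)
next
  case (snoc g gs)
  let ?ws = "foldl (\<lambda>ws g. ws @ [gate_value ws g]) x gs"
  from snoc have ok: "gates_ok (length x) gs" "\<forall>j\<in>operands g. j < length x + length gs"
    by (auto simp: gates_ok_append gates_ok_Cons)
  with snoc have len: "length ?ws = length x + length gs" and take: "take (length x) ?ws = x"
    and sat: "sat ((!) ?ws) (length x) gs"
    by auto
  let ?w = "(!) (?ws @ [gate_value ?ws g])"
  have old: "?w j = ?ws ! j" if "j < length x + length gs" for j
    using that by (simp add: nth_append len)
  have "sat ?w (length x) gs"
    unfolding sat_def
  proof (intro allI impI)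
    fix j
    assume j: "j < length gs"
    have "gate_fun ?w (gs ! j) = gate_fun ((!) ?ws) (gs ! j)"
      using ok j by (intro gate_fun_cong old) (fastforce simp: gates_ok_def)
    with sat j show "?w (length x + j) = gate_fun ?w (gs ! j)"
      by (simp add: old sat_def)
  qed
  moreover have "gate_fun ?w g = gate_fun ((!) ?ws) g"
    using ok by (intro gate_fun_cong old) auto
  moreover have "?w (length x + length gs) = gate_fun ((!) ?ws) g"
    by (simp add: nth_append len gate_value_eq[of ?ws])
  ultimately show ?case
    using len take by (simp add: sat_append sat_Cons sat_Nil)
qed

lemma wires_sat:
  assumes "circuit_wf C" "length x = inputs C"
  shows "sat ((!) (wires C x)) (inputs C) (gates C)" "i < inputs C \<Longrightarrow> wires C x ! i = x ! i"
proof -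
  have "gates_ok (length x) (gates C)"
    using assms by (simp add: circuit_wf_def gates_ok_def)
  from foldl_gates_sat[OF this] assms
  have *: "take (length x) (wires C x) = x" "sat ((!) (wires C x)) (inputs C) (gates C)"
    by (auto simp: wires_def)
  show "sat ((!) (wires C x)) (inputs C) (gates C)" by fact
  show "i < inputs C \<Longrightarrow> wires C x ! i = x ! i"
    using *(1) assms(2) by (metis nth_take)
qed

section \<open>Relocated copies of a circuit\<close>

fun shift_gate :: "nat \<Rightarrow> gate \<Rightarrow> gate" where
  "shift_gate k (ConstG b) = ConstG b"
| "shift_gate k (NotG i) = NotG (i + k)"
| "shift_gate k (AndG i j) = AndG (i + k) (j + k)"
| "shift_gate k (OrG i j) = OrG (i + k) (j + k)"

lemma gate_fun_shift: "gate_fun w (shift_gate k g) = gate_fun (\<lambda>i. w (i + k)) g"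
  by (cases g) auto

lemma operands_shift: "operands (shift_gate k g) = (\<lambda>i. i + k) ` operands g"
  by (cases g) auto

lemma gates_ok_shift:
  "circuit_wf C \<Longrightarrow> L = k + inputs C \<Longrightarrow> gates_ok L (map (shift_gate k) (gates C))"
  by (auto simp: gates_ok_def circuit_wf_def operands_shift)

text \<open>The equations also determine the solution: operands have smaller numbers than the wire
  they drive, so strong induction identifies every relocated wire.\<close>

lemma sat_shift:
  assumes wf: "circuit_wf C" "length x = inputs C"
    and x: "\<And>i. i < inputs C \<Longrightarrow> w (k + i) = x ! i"
    and sat: "sat w (k + inputs C) (map (shift_gate k) (gates C))"
  shows "j < inputs C + length (gates C) \<Longrightarrow> w (k + j) = wires C x ! j"
proof (induction j rule: less_induct)
  case (less j)
  show ?case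
  proof (cases "j < inputs C")
    case True
    then show ?thesis using x wires_sat(2)[OF wf] by simp
  next
    case False
    define i where "i = j - inputs C"
    have i: "j = inputs C + i" "i < length (gates C)"
      using False less.prems by (auto simp: i_def)
    have "w (k + j) = gate_fun (\<lambda>l. w (l + k)) (gates C ! i)"
      using sat i by (auto simp: sat_def gate_fun_shift add.assoc)
    also have "\<dots> = gate_fun ((!) (wires C x)) (gates C ! i)"
    proof (rule gate_fun_cong)
      fix l
      assume "l \<in> operands (gates C ! i)"
      then have "l < j" using wf(1) i by (auto simp: circuit_wf_def)
      with less.IH[of l] less.prems show "w (l + k) = wires C x ! l"
        by (simp add: add.commute)
    qed
    also have "\<dots> = wires C x ! j"
      using wires_sat(1)[OF wf] i by (auto simp: sat_def)
    finally show ?thesis .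
  qed
qed

section \<open>Gates computing Boolean formulas\<close>

datatype 'a formula = Wire 'a | Lit bool | Neg "'a formula"
  | Conj "'a formula" "'a formula" | Disj "'a formula" "'a formula"

fun truth :: "('a \<Rightarrow> bool) \<Rightarrow> 'a formula \<Rightarrow> bool" where
  "truth w (Wire a) = w a"
| "truth w (Lit b) = b"
| "truth w (Neg f) = (\<not> truth w f)"
| "truth w (Conj f g) = (truth w f \<and> truth w g)"
| "truth w (Disj f g) = (truth w f \<or> truth w g)"

text \<open>
  One gate per node in postorder, so the value of \<open>formula_gates f L\<close> is on wire \<open>L + steps f\<close>.
\<close>

fun steps :: "'a formula \<Rightarrow> nat" where
  "steps (Wire a) = 0"
| "steps (Lit b) = 0"
| "steps (Neg f) = Suc (steps f)"
| "steps (Conj f g) = Suc (Suc (steps f + steps g))"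
| "steps (Disj f g) = Suc (Suc (steps f + steps g))"

fun formula_gates :: "nat formula \<Rightarrow> nat \<Rightarrow> gate list" where
  "formula_gates (Wire a) L = [AndG a a]"
| "formula_gates (Lit b) L = [ConstG b]"
| "formula_gates (Neg f) L = formula_gates f L @ [NotG (L + steps f)]"
| "formula_gates (Conj f g) L = formula_gates f L @ formula_gates g (L + Suc (steps f)) @
     [AndG (L + steps f) (L + Suc (steps f + steps g))]"
| "formula_gates (Disj f g) L = formula_gates f L @ formula_gates g (L + Suc (steps f)) @
     [OrG (L + steps f) (L + Suc (steps f + steps g))]"

lemma length_formula_gates: "length (formula_gates f L) = Suc (steps f)"
  by (induction f arbitrary: L) auto

text \<open>The same formulas are used over wire numbers in circuits and over address expressions in
  the printing program. \<open>map_formula\<close> connects the two and must not disturb the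
  layout.\<close>

lemma steps_map_formula: "steps (map_formula h f) = steps f"
  by (induction f) auto

lemma sat_formula_gates: "sat w L (formula_gates f L) \<Longrightarrow> w (L + steps f) = truth w f"
proof (induction f arbitrary: L)
  case (Conj f g)
  from Conj.IH(1)[of L] Conj.IH(2)[of "L + Suc (steps f)"] Conj.prems show ?case
    by (simp add: sat_append sat_Cons length_formula_gates add.assoc)
next
  case (Disj f g)
  from Disj.IH(1)[of L] Disj.IH(2)[of "L + Suc (steps f)"] Disj.prems show ?case
    by (simp add: sat_append sat_Cons length_formula_gates add.assoc)
qed (auto simp: sat_append sat_Cons length_formula_gates)

lemma sat_formula_at: "sat w L (formula_gates f L) \<Longrightarrow> a = L + steps f \<Longrightarrow> w a = truth w f"
  using sat_formula_gates by simp

lemma gates_ok_formula_gates: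
  "(\<And>a. a \<in> set_formula f \<Longrightarrow> a < L) \<Longrightarrow> gates_ok L (formula_gates f L)"
proof (induction f arbitrary: L)
  case (Conj f g)
  have "gates_ok L (formula_gates f L)"
    by (rule Conj.IH(1), rule Conj.prems, simp)
  moreover have "gates_ok (L + Suc (steps f)) (formula_gates g (L + Suc (steps f)))"
    by (rule Conj.IH(2), rule trans_less_add1, rule Conj.prems, simp)
  ultimately show ?case
    by (simp add: gates_ok_append gates_ok_Cons gates_ok_Nil length_formula_gates)
next
  case (Disj f g)
  have "gates_ok L (formula_gates f L)"
    by (rule Disj.IH(1), rule Disj.prems, simp)
  moreover have "gates_ok (L + Suc (steps f)) (formula_gates g (L + Suc (steps f)))"
    by (rule Disj.IH(2), rule trans_less_add1, rule Disj.prems, simp)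
  ultimately show ?case
    by (simp add: gates_ok_append gates_ok_Cons gates_ok_Nil length_formula_gates)
qed (auto simp: gates_ok_append gates_ok_Cons gates_ok_Nil length_formula_gates)

text \<open>All formulas of a row are meant to have exactly \<open>r\<close> gates. The value of
  formula \<open>i\<close> is then on wire \<open>L + r * i + (r - 1)\<close>, an address linear in
  \<open>i\<close>.\<close>

definition row :: "nat \<Rightarrow> (nat \<Rightarrow> nat formula) \<Rightarrow> nat \<Rightarrow> nat \<Rightarrow> gate list" where
  "row r F k L = concat (map (\<lambda>i. formula_gates (F i) (L + r * i)) [0..<k])"

lemma row_Suc: "row r F (Suc k) L = row r F k L @ formula_gates (F k) (L + r * k)"
  by (simp add: row_def)

lemma length_row: "(\<And>i. i < k \<Longrightarrow> Suc (steps (F i)) = r) \<Longrightarrow> length (row r F k L) = r * k"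
  by (induction k) (simp_all add: row_Suc length_formula_gates, simp add: row_def)

lemma sat_row:
  assumes "sat w L (row r F k L)" "\<And>i. i < k \<Longrightarrow> Suc (steps (F i)) = r" "i < k"
  shows "w (L + r * i + (r - 1)) = truth w (F i)"
  using assms
proof (induction k)
  case (Suc k)
  then have len: "length (row r F k L) = r * k"
    by (intro length_row) simp
  show ?case
  proof (cases "i = k")
    case True
    have "sat w (L + r * k) (formula_gates (F k) (L + r * k))"
      using Suc.prems(1) by (simp add: row_Suc sat_append len)
    from sat_formula_gates[OF this] Suc.prems(2)[of k] True show ?thesis
      by auto
  next
    case False
    with Suc show ?thesis by (simp add: row_Suc sat_append)
  qed
qed simp

lemma gates_ok_row:
  assumes "\<And>i. i < k \<Longrightarrow> Suc (steps (F i)) = r"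
    "\<And>i a. i < k \<Longrightarrow> a \<in> set_formula (F i) \<Longrightarrow> a < L + r * i"
  shows "gates_ok L (row r F k L)"
  using assms
proof (induction k)
  case 0
  show ?case by (simp add: row_def gates_ok_Nil)
next
  case (Suc k)
  then have "length (row r F k L) = r * k"
    by (intro length_row) simp
  with Suc show ?case
    by (simp add: row_Suc gates_ok_append gates_ok_formula_gates)
qed

section \<open>Words on consecutive wires and their binary values\<close>

definition word :: "(nat \<Rightarrow> bool) \<Rightarrow> nat \<Rightarrow> nat \<Rightarrow> bool list" where
  "word w a k = map (\<lambda>i. w (a + i)) [0..<k]"

lemma length_word [simp]: "length (word w a k) = k"
  by (simp add: word_def)

lemma word_Suc: "word w a (Suc k) = word w a k @ [w (a + k)]"
  by (simp add: word_def)

lemma word_Suc': "word w a (Suc k) = w a # word w (Suc a) k"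
  by (simp add: word_def upt_conv_Cons map_Suc_upt[symmetric] del: upt_Suc)

lemma word_add: "word w a (j + l) = word w a j @ word w (a + j) l"
  by (induction l) (simp_all add: word_Suc add.assoc, simp add: word_def)

lemma word_eq_iff: "word w a k = xs \<longleftrightarrow> length xs = k \<and> (\<forall>i<k. w (a + i) = xs ! i)"
  by (auto simp: word_def list_eq_iff_nth_eq)

lemma bits_value_Nil [simp]: "bits_value [] = 0"
  and bits_value_Cons [simp]: "bits_value (b # bs) = of_bool b + 2 * bits_value bs"
  by (simp_all add: bits_value_def)

lemma bits_value_append: "bits_value (xs @ ys) = bits_value xs + 2 ^ length xs * bits_value ys"
  by (induction xs) (auto simp: algebra_simps)

lemma bits_value_less: "bits_value xs < 2 ^ length xs"
  by (induction xs) auto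

lemma bits_value_inject: "length xs = length ys \<Longrightarrow> bits_value xs = bits_value ys \<longleftrightarrow> xs = ys"
proof (induction xs ys rule: list_induct2)
  case (Cons x xs y ys)
  moreover have "of_bool x + 2 * a = of_bool y + 2 * b \<longleftrightarrow> x = y \<and> a = b" for a b :: nat
    by (cases x; cases y; simp) presburger+
  ultimately show ?case by simp
qed simp

lemma bits_value_zeros [simp]: "bits_value (zeros n) = 0"
  by (induction n) auto

section \<open>Comparators, incrementer and decrementer\<close>

definition eq_formula :: "'a formula \<Rightarrow> 'a \<Rightarrow> 'a \<Rightarrow> 'a formula" where
  "eq_formula c a b = Conj c (Disj (Conj (Wire a) (Wire b)) (Neg (Disj (Wire a) (Wire b))))"

text \<open>One step of a comparison whose bits arrive from the least significant end: differing
  bits overrule the verdict \<open>c\<close> reached so far, equal bits keep it.\<close>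

definition less_formula :: "'a formula \<Rightarrow> 'a \<Rightarrow> 'a \<Rightarrow> 'a formula" where
  "less_formula c a b =
     Disj (Conj (Neg (Wire a)) (Wire b)) (Conj (Disj (Neg (Wire a)) (Wire b)) c)"

definition mux_formula :: "'a formula \<Rightarrow> 'a formula \<Rightarrow> 'a formula \<Rightarrow> 'a formula" where
  "mux_formula c f g = Disj (Conj c f) (Conj (Neg c) g)"

definition xor_formula :: "'a \<Rightarrow> 'a \<Rightarrow> 'a formula" where
  "xor_formula a b = Disj (Conj (Wire a) (Neg (Wire b))) (Conj (Neg (Wire a)) (Wire b))"

text \<open>
  In the uses of \<open>scan\<close> the formula \<open>F i\<close> reads the current state from wire \<open>L + r * i\<close>.
\<close>

definition scan :: "bool \<Rightarrow> nat \<Rightarrow> (nat \<Rightarrow> nat formula) \<Rightarrow> nat \<Rightarrow> nat \<Rightarrow> gate list" where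
  "scan b r F k L = ConstG b # row r F k (Suc L)"

lemma length_scan: "(\<And>i. i < k \<Longrightarrow> Suc (steps (F i)) = r) \<Longrightarrow> length (scan b r F k L) = Suc (r * k)"
  by (simp add: scan_def length_row)

lemma sat_scan:
  assumes "sat w L (scan b r F k L)" "\<And>i. i < k \<Longrightarrow> Suc (steps (F i)) = r"
  shows "w L = b" "i < k \<Longrightarrow> w (L + r * Suc i) = truth w (F i)"
proof -
  from assms(1) show "w L = b" by (simp add: scan_def sat_Cons)
  from assms(1) have "sat w (Suc L) (row r F k (Suc L))" by (simp add: scan_def sat_Cons)
  from sat_row[OF this assms(2), of i] have *: "i < k \<Longrightarrow> w (Suc L + r * i + (r - 1)) = truth w (F i)"
    by simp
  show "w (L + r * Suc i) = truth w (F i)" if "i < k"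
  proof -
    have "Suc L + r * i + (r - 1) = L + r * Suc i" using assms(2)[OF that] by simp
    with *[OF that] show ?thesis by metis
  qed
qed

lemma gates_ok_scan:
  assumes "\<And>i. i < k \<Longrightarrow> Suc (steps (F i)) = r"
    "\<And>i a. i < k \<Longrightarrow> a \<in> set_formula (F i) \<Longrightarrow> a \<le> L + r * i"
  shows "gates_ok L (scan b r F k L)"
  using assms by (auto simp: scan_def gates_ok_Cons less_Suc_eq_le intro!: gates_ok_row)

definition equal_gates :: "nat \<Rightarrow> nat \<Rightarrow> nat \<Rightarrow> nat \<Rightarrow> gate list" where
  "equal_gates a b k L =
     scan True 10 (\<lambda>i. eq_formula (Wire (L + 10 * i)) (a + i) (b + i)) k L"

lemma length_equal_gates: "length (equal_gates a b k L) = Suc (10 * k)"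
  by (simp add: equal_gates_def length_scan eq_formula_def)

lemma sat_equal_gates:
  assumes "sat w L (equal_gates a b k L)"
  shows "w (L + 10 * k) \<longleftrightarrow> word w a k = word w b k"
proof -
  note * = sat_scan[OF assms[unfolded equal_gates_def]]
  have "w (L + 10 * j) \<longleftrightarrow> word w a j = word w b j" if "j \<le> k" for j
    using that
  proof (induction j)
    case 0
    show ?case using *(1) by (simp add: word_def eq_formula_def)
  next
    case (Suc j)
    then show ?case using *(2)[of j] by (auto simp: eq_formula_def word_Suc)
  qed
  then show ?thesis by simp
qed

lemma gates_ok_equal_gates: "a + k \<le> L \<Longrightarrow> b + k \<le> L \<Longrightarrow> gates_ok L (equal_gates a b k L)"
  unfolding equal_gates_def by (rule gates_ok_scan) (auto simp: eq_formula_def)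

definition less_gates :: "nat \<Rightarrow> nat \<Rightarrow> nat \<Rightarrow> nat \<Rightarrow> gate list" where
  "less_gates a b k L =
     scan False 11 (\<lambda>i. less_formula (Wire (L + 11 * i)) (a + i) (b + i)) k L"

lemma length_less_gates: "length (less_gates a b k L) = Suc (11 * k)"
  by (simp add: less_gates_def length_scan less_formula_def)

lemma sat_less_gates:
  assumes "sat w L (less_gates a b k L)"
  shows "w (L + 11 * k) \<longleftrightarrow> bits_value (word w a k) < bits_value (word w b k)"
proof -
  note * = sat_scan[OF assms[unfolded less_gates_def]]
  have "w (L + 11 * j) \<longleftrightarrow> bits_value (word w a j) < bits_value (word w b j)" if "j \<le> k" for j
    using that
  proof (induction j)
    case 0
    show ?case using *(1) by (simp add: word_def less_formula_def)
  next
    case (Suc j)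
    \<comment> \<open>The new bits have weight \<open>2 ^ j\<close>, which exceeds the value of
      either shorter word, so they decide whenever they differ.\<close>
    then show ?case
      using *(2)[of j] bits_value_less[of "word w a j"] bits_value_less[of "word w b j"]
      by (cases "w (a + j)"; cases "w (b + j)")
        (auto simp: less_formula_def word_Suc bits_value_append)
  qed
  then show ?thesis by simp
qed

lemma gates_ok_less_gates: "a + k \<le> L \<Longrightarrow> b + k \<le> L \<Longrightarrow> gates_ok L (less_gates a b k L)"
  unfolding less_gates_def by (rule gates_ok_scan) (auto simp: less_formula_def)

text \<open>Only the carries are computed, starting from the added 1 as incoming carry. The sum bits
  are exclusive ors with them and are formed where they are consumed.\<close>

definition carry_gates :: "nat \<Rightarrow> nat \<Rightarrow> nat \<Rightarrow> gate list" where
  "carry_gates a k L = scan True 3 (\<lambda>i. Conj (Wire (L + 3 * i)) (Wire (a + i))) k L"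

lemma length_carry_gates: "length (carry_gates a k L) = Suc (3 * k)"
  by (simp add: carry_gates_def length_scan)

text \<open>Keeping the final carry in the identity serves two purposes: dropping it yields the
  residue modulo \<open>2 ^ k\<close> for the step, keeping it yields the meter with
  \<open>k + 1\<close> bits.\<close>

lemma sat_carry_gates:
  assumes "sat w L (carry_gates a k L)"
  shows "bits_value (map (\<lambda>i. w (a + i) \<noteq> w (L + 3 * i)) [0..<k]) + 2 ^ k * of_bool (w (L + 3 * k)) =
    bits_value (word w a k) + 1"
proof -
  note * = sat_scan[OF assms[unfolded carry_gates_def]]
  have "bits_value (map (\<lambda>i. w (a + i) \<noteq> w (L + 3 * i)) [0..<j]) + 2 ^ j * of_bool (w (L + 3 * j)) =
    bits_value (word w a j) + 1" if "j \<le> k" for j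
    using that
  proof (induction j)
    case 0
    show ?case using *(1) by (simp add: word_def)
  next
    case (Suc j)
    then show ?case
      using *(2)[of j]
      by (cases "w (a + j)"; cases "w (L + 3 * j)") (auto simp: word_Suc bits_value_append)
  qed
  then show ?thesis by simp
qed

lemma gates_ok_carry_gates: "a + k \<le> L \<Longrightarrow> gates_ok L (carry_gates a k L)"
  unfolding carry_gates_def by (rule gates_ok_scan) auto

definition borrow_gates :: "nat \<Rightarrow> nat \<Rightarrow> nat \<Rightarrow> gate list" where
  "borrow_gates a k L = scan True 4 (\<lambda>i. Conj (Wire (L + 4 * i)) (Neg (Wire (a + i)))) k L"

lemma length_borrow_gates: "length (borrow_gates a k L) = Suc (4 * k)"
  by (simp add: borrow_gates_def length_scan)

text \<open>The final borrow is moved to the other side so that no truncated subtraction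
  occurs.\<close>

lemma sat_borrow_gates:
  assumes "sat w L (borrow_gates a k L)"
  shows "bits_value (map (\<lambda>i. w (a + i) \<noteq> w (L + 4 * i)) [0..<k]) + 1 =
    bits_value (word w a k) + 2 ^ k * of_bool (w (L + 4 * k))"
proof -
  note * = sat_scan[OF assms[unfolded borrow_gates_def]]
  have "bits_value (map (\<lambda>i. w (a + i) \<noteq> w (L + 4 * i)) [0..<j]) + 1 =
    bits_value (word w a j) + 2 ^ j * of_bool (w (L + 4 * j))" if "j \<le> k" for j
    using that
  proof (induction j)
    case 0
    show ?case using *(1) by (simp add: word_def)
  next
    case (Suc j)
    then show ?case
      using *(2)[of j]
      by (cases "w (a + j)"; cases "w (L + 4 * j)") (auto simp: word_Suc bits_value_append)
  qed
  then show ?thesis by simp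
qed

lemma gates_ok_borrow_gates: "a + k \<le> L \<Longrightarrow> gates_ok L (borrow_gates a k L)"
  unfolding borrow_gates_def by (rule gates_ok_scan) auto

section \<open>Calling a circuit as a subroutine\<close>

definition copy_gates :: "nat \<Rightarrow> nat \<Rightarrow> nat \<Rightarrow> gate list" where
  "copy_gates a k L = row 1 (\<lambda>i. Wire (a + i)) k L"

lemma length_copy_gates: "length (copy_gates a k L) = k"
  by (simp add: copy_gates_def length_row)

lemma sat_copy_gates: "sat w L (copy_gates a k L) \<Longrightarrow> word w L k = word w a k"
  using sat_row[of w L 1 "\<lambda>i. Wire (a + i)" k] by (simp add: copy_gates_def word_def)

lemma gates_ok_copy_gates: "a + k \<le> L \<Longrightarrow> gates_ok L (copy_gates a k L)"
  unfolding copy_gates_def by (rule gates_ok_row) auto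

text \<open>The outputs of a given circuit may be scattered over its wires. They are gathered on
  consecutive wires, each by an AND of a wire with itself because there is no buffer gate, so that
  later sections can address them as a word.\<close>

definition output_gates :: "nat \<Rightarrow> nat list \<Rightarrow> nat \<Rightarrow> gate list" where
  "output_gates k os L = row 1 (\<lambda>i. Wire (os ! i + k)) (length os) L"

lemma length_output_gates: "length (output_gates k os L) = length os"
  by (simp add: output_gates_def length_row)

lemma sat_output_gates:
  "sat w L (output_gates k os L) \<Longrightarrow> word w L (length os) = map (\<lambda>j. w (k + j)) os"
  using sat_row[of w L 1 "\<lambda>i. Wire (os ! i + k)" "length os"]
  by (simp add: output_gates_def word_eq_iff add.commute)

lemma gates_ok_output_gates:
  "(\<And>j. j \<in> set os \<Longrightarrow> j + k < L) \<Longrightarrow> gates_ok L (output_gates k os L)"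
  unfolding output_gates_def by (rule gates_ok_row) (auto simp: trans_less_add1)

text \<open>A call has three pieces: arguments copied to where the relocated input wires are, the
  relocated gates, and the gathered outputs. The output piece may start at any \<open>L\<close>,
  which leaves room for a bit in front of the result.\<close>

lemma sat_call:
  assumes wf: "circuit_wf C"
    and sat: "sat w k (copy_gates a (inputs C) k)"
      "sat w (k + inputs C) (map (shift_gate k) (gates C))"
      "sat w L (output_gates k (outputs C) L)"
  shows "word w L (length (outputs C)) = ceval C (word w a (inputs C))"
proof -
  have x: "w (k + i) = word w a (inputs C) ! i" if "i < inputs C" for i
    using sat_copy_gates[OF sat(1)] that by (auto simp: word_eq_iff)
  have "w (k + j) = wires C (word w a (inputs C)) ! j" if "j \<in> set (outputs C)" for j
    using wf that by (intro sat_shift[OF wf _ x sat(2)]) (auto simp: circuit_wf_def)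
  with sat_output_gates[OF sat(3)] show ?thesis
    by (auto simp: ceval_def)
qed


section \<open>The circuits of the reduction\<close>

text \<open>Each recorded address is compared with the recorded address of the preceding section
  plus its length, so every condition involves only two neighbouring sections. Once it holds, the
  body can be treated as a set of sections with absolute addresses.\<close>

fun aligned :: "nat \<Rightarrow> (nat \<times> gate list) list \<Rightarrow> bool" where
  "aligned L [] \<longleftrightarrow> True"
| "aligned L [(a, gs)] \<longleftrightarrow> a = L"
| "aligned L ((a, gs) # (b, hs) # ss) \<longleftrightarrow> a = L \<and> aligned (a + length gs) ((b, hs) # ss)"

lemma sat_aligned:
  "aligned L ss \<Longrightarrow> sat w L (concat (map snd ss)) \<longleftrightarrow> (\<forall>(a, gs)\<in>set ss. sat w a gs)"
  by (induction L ss rule: aligned.induct) (auto simp: sat_append sat_Nil)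

lemma gates_ok_aligned:
  "aligned L ss \<Longrightarrow> gates_ok L (concat (map snd ss)) \<longleftrightarrow> (\<forall>(a, gs)\<in>set ss. gates_ok a gs)"
  by (induction L ss rule: aligned.induct) (auto simp: gates_ok_append gates_ok_Nil)

definition active_formula :: "'a \<Rightarrow> 'a \<Rightarrow> 'a \<Rightarrow> 'a \<Rightarrow> 'a \<Rightarrow> 'a \<Rightarrow> 'a formula" where
  "active_formula s p l h al bh =
     Conj (Neg (Conj (Wire s) (Wire p))) (Disj (Disj (Wire l) (Wire h)) (Conj (Wire al) (Wire bh)))"

definition vertex_formula :: "'a \<Rightarrow> 'a \<Rightarrow> 'a \<Rightarrow> 'a formula" where
  "vertex_formula sel y x = mux_formula (Wire sel) (Wire y) (Wire x)"

text \<open>With \<open>c\<close> the incoming carry or borrow, the exclusive or with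
  \<open>q\<close> is the corresponding bit of the incremented or decremented level.\<close>

definition level_formula :: "'a \<Rightarrow> 'a \<Rightarrow> 'a \<Rightarrow> 'a \<Rightarrow> 'a \<Rightarrow> 'a formula" where
  "level_formula sel act b q c =
     mux_formula (Wire sel) (Wire b) (mux_formula (Wire act) (xor_formula q c) (Wire q))"

definition meter_formula :: "'a \<Rightarrow> 'a \<Rightarrow> 'a \<Rightarrow> 'a formula" where
  "meter_formula act q c = Conj (Wire act) (xor_formula q c)"

lemmas formula_defs = active_formula_def vertex_formula_def level_formula_def meter_formula_def
  mux_formula_def xor_formula_def

locale reduction =
  fixes I :: line_instance
begin

definition "n = inputs (circuit_S I)"
definition "m = length (outputs (circuit_V I))"
definition "k = m + 1"
definition "gS = length (gates (circuit_S I))"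
definition "gP = length (gates (circuit_P I))"
definition "gV = length (gates (circuit_V I))"

text \<open>Wires below \<open>n\<close> carry \<open>x\<close>, the next \<open>k\<close> carry
  \<open>q\<close>. The names below are numbers of wires: starts of blocks, or single bits such as
  \<open>act\<close>, \<open>leave\<close> and \<open>enter\<close>. \<open>callV\<close> and
  \<open>callW\<close> begin two copies of the potential circuit, run on \<open>x\<close> and on
  \<open>S x\<close>.\<close>

definition "callS = n + k"
definition "succ_at = callS + n + gS"
definition "callP = succ_at + n"
definition "pred_at = callP + n + gP"
definition "eqS = pred_at + n"
definition "eqP = eqS + 10 * n + 1"
definition "callV = eqP + 10 * n + 1"
definition "low_at = callV + n + gV + 1"
definition "even_low_at = low_at + k"
definition "callW = even_low_at + k"
definition "high_at = callW + n + gV"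
definition "even_high_at = high_at + k"
definition "is_low = even_high_at + k"
definition "is_high = is_low + 10 * k + 1"
definition "above_low = is_high + 10 * k + 1"
definition "below_high = above_low + 11 * k + 1"
definition "carry_at = below_high + 11 * k + 1"
definition "borrow_at = carry_at + 3 * k + 1"
text \<open>The borrow scan has \<open>4 * k + 1\<close> gates and \<open>active_formula\<close> has
  12, the last of which carries the value.\<close>

definition "act = borrow_at + 4 * k + 12"
definition "leave = act + 3"
definition "enter = leave + 3"
definition "succ_vertex = enter + 1"
definition "succ_level = succ_vertex + 8 * n"
definition "pred_vertex = succ_level + 23 * k"
definition "pred_level = pred_vertex + 8 * n"
definition "meter_at = pred_level + 23 * k"
definition "meter_top = meter_at + 11 * k + 2"
definition "false_at = meter_top + 1"

lemmas layout = k_def callS_def succ_at_def callP_def pred_at_def eqS_def eqP_def callV_def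
  low_at_def even_low_at_def callW_def high_at_def even_high_at_def is_low_def is_high_def
  above_low_def below_high_def carry_at_def borrow_at_def act_def leave_def enter_def
  succ_vertex_def succ_level_def pred_vertex_def pred_level_def meter_at_def meter_top_def
  false_at_def

definition sections :: "(nat \<times> gate list) list" where
  "sections = [
    (callS, copy_gates 0 n callS),
    (callS + n, map (shift_gate callS) (gates (circuit_S I))),
    (succ_at, output_gates callS (outputs (circuit_S I)) succ_at),
    (callP, copy_gates 0 n callP),
    (callP + n, map (shift_gate callP) (gates (circuit_P I))),
    (pred_at, output_gates callP (outputs (circuit_P I)) pred_at),
    (eqS, equal_gates succ_at 0 n eqS),
    (eqP, equal_gates pred_at 0 n eqP),
    (callV, copy_gates 0 n callV),
    (callV + n, map (shift_gate callV) (gates (circuit_V I))),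
    (callV + n + gV, formula_gates (Neg (Wire (eqP + 10 * n))) (callV + n + gV)),
    (low_at + 1, output_gates callV (outputs (circuit_V I)) (low_at + 1)),
    (even_low_at, formula_gates (Lit False) even_low_at),
    (even_low_at + 1, copy_gates (low_at + 1) m (even_low_at + 1)),
    (callW, copy_gates succ_at n callW),
    (callW + n, map (shift_gate callW) (gates (circuit_V I))),
    (high_at, formula_gates (Lit True) high_at),
    (high_at + 1, output_gates callW (outputs (circuit_V I)) (high_at + 1)),
    (even_high_at, formula_gates (Lit False) even_high_at),
    (even_high_at + 1, copy_gates (high_at + 1) m (even_high_at + 1)),
    (is_low, equal_gates n low_at k is_low),
    (is_high, equal_gates n even_high_at k is_high),
    (above_low, less_gates low_at n k above_low),
    (below_high, less_gates n high_at k below_high),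
    (carry_at, carry_gates n k carry_at),
    (borrow_at, borrow_gates n k borrow_at),
    (borrow_at + 4 * k + 1,
      formula_gates (active_formula (eqS + 10 * n) (eqP + 10 * n) (is_low + 10 * k)
        (is_high + 10 * k) (above_low + 11 * k) (below_high + 11 * k)) (borrow_at + 4 * k + 1)),
    (act + 1, formula_gates (Conj (Wire act) (Wire (is_high + 10 * k))) (act + 1)),
    (leave + 1, formula_gates (Conj (Wire act) (Wire (is_low + 10 * k))) (leave + 1)),
    (succ_vertex, row 8 (\<lambda>i. vertex_formula leave (succ_at + i) i) n succ_vertex),
    (succ_level,
      row 23 (\<lambda>i. level_formula leave act (high_at + i) (n + i) (carry_at + 3 * i)) k succ_level),
    (pred_vertex, row 8 (\<lambda>i. vertex_formula enter (pred_at + i) i) n pred_vertex),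
    (pred_level,
      row 23 (\<lambda>i. level_formula enter act (even_low_at + i) (n + i) (borrow_at + 4 * i)) k pred_level),
    (meter_at, row 11 (\<lambda>i. meter_formula act (n + i) (carry_at + 3 * i)) k meter_at),
    (meter_at + 11 * k, formula_gates (Conj (Wire act) (Wire (carry_at + 3 * k))) (meter_at + 11 * k)),
    (false_at, formula_gates (Lit False) false_at)]"

definition body :: "gate list" where
  "body = concat (map snd sections)"

text \<open>The offsets 7 and 22 select the last gate of each block of 8 and 23 gates.\<close>

definition vertex_outs :: "nat \<Rightarrow> nat \<Rightarrow> nat list" where
  "vertex_outs v l = map (\<lambda>i. v + 8 * i + 7) [0..<n] @ map (\<lambda>i. l + 23 * i + 22) [0..<k]"

text \<open>In dimension \<open>n + k\<close> the value circuit needs \<open>n + k + 1\<close>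
  output bits. The meter \<open>q + 1\<close> can reach \<open>2 ^ k\<close>, so the final carry
  supplies one bit above the \<open>k\<close> sum bits, and \<open>n\<close> constant bits pad the
  rest.\<close>

definition meter_outs :: "nat list" where
  "meter_outs = map (\<lambda>i. meter_at + 11 * i + 10) [0..<k] @ [meter_top] @ map (\<lambda>i. false_at) [0..<n]"

text \<open>The three circuits of the new instance share their gates and differ only in the outputs.\<close>

definition with_outputs :: "nat list \<Rightarrow> circuit" where
  "with_outputs os = \<lparr>inputs = n + k, gates = body, outputs = os\<rparr>"

definition reduced :: line_instance where
  "reduced = \<lparr>circuit_S = with_outputs (vertex_outs succ_vertex succ_level),
     circuit_P = with_outputs (vertex_outs pred_vertex pred_level),
     circuit_V = with_outputs meter_outs\<rparr>"

lemmas section_lengths = length_copy_gates length_output_gates length_equal_gates length_less_gates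
  length_carry_gates length_borrow_gates length_formula_gates length_row

end

section \<open>Soundness of the layout for valid instances\<close>

locale valid_reduction = reduction +
  assumes inst: "EOPL_instance I"
begin

lemma
  circuits: "circuit_wf (circuit_S I)" "circuit_wf (circuit_P I)" "circuit_wf (circuit_V I)"
    "inputs (circuit_S I) = n" "inputs (circuit_P I) = n" "inputs (circuit_V I) = n"
    "length (outputs (circuit_S I)) = n" "length (outputs (circuit_P I)) = n"
    "length (outputs (circuit_V I)) = m" and
  dim: "dim I = n" and
  origin: "pred_of I (zeros n) = zeros n" "succ_of I (zeros n) \<noteq> zeros n"
    "bits_value (ceval (circuit_V I) (zeros n)) = 0"
  using inst
  by (auto simp: EOPL_instance_def Let_def is_circuit_def dim_def n_def m_def val_of_def)

lemma sections_aligned: "aligned (n + k) sections" and body_length: "n + k + length body = false_at + 1"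
proof -
  note [simp] = section_lengths formula_defs circuits gS_def[symmetric] gP_def[symmetric]
    gV_def[symmetric]
  show "aligned (n + k) sections"
    unfolding sections_def aligned.simps
    by simp (use layout in \<open>intro conjI; linarith\<close>)
  show "n + k + length body = false_at + 1"
    unfolding body_def sections_def
    by simp (use layout in linarith)
qed

lemma output_bound: "j \<in> set (outputs (circuit_S I)) \<Longrightarrow> j < n + gS"
  "j \<in> set (outputs (circuit_P I)) \<Longrightarrow> j < n + gP"
  "j \<in> set (outputs (circuit_V I)) \<Longrightarrow> j < n + gV"
  using circuits by (auto simp: circuit_wf_def gS_def gP_def gV_def)

lemma gates_ok_outputs:
  "callS + n + gS \<le> L \<Longrightarrow> gates_ok L (output_gates callS (outputs (circuit_S I)) L)"
  "callP + n + gP \<le> L \<Longrightarrow> gates_ok L (output_gates callP (outputs (circuit_P I)) L)"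
  "callV + n + gV \<le> L \<Longrightarrow> gates_ok L (output_gates callV (outputs (circuit_V I)) L)"
  "callW + n + gV \<le> L \<Longrightarrow> gates_ok L (output_gates callW (outputs (circuit_V I)) L)"
  using output_bound by (auto intro!: gates_ok_output_gates) fastforce+

lemma body_ok: "gates_ok (n + k) body"
proof -
  \<comment> \<open>Turns each membership goal about a pair into a goal to which the rules for
    \<open>gates_ok\<close> apply.\<close>
  have entry: "case (a, gs) of (a, gs) \<Rightarrow> gates_ok a gs" if "gates_ok a gs" for a gs
    using that by simp
  show ?thesis
    unfolding body_def gates_ok_aligned[OF sections_aligned]
    unfolding sections_def list.set ball_simps
    by (intro conjI TrueI entry gates_ok_outputs gates_ok_copy_gates gates_ok_shift
        gates_ok_equal_gates gates_ok_less_gates gates_ok_carry_gates gates_ok_borrow_gates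
        gates_ok_formula_gates gates_ok_row)
      (simp_all add: circuits formula_defs, ((elim disjE)?, use layout in linarith)+)
qed

sublocale line: potential_line "succ_of I" "pred_of I" "\<lambda>x. bits_value (ceval (circuit_V I) x)" "zeros n" m
proof
  show "bits_value (ceval (circuit_V I) x) < 2 ^ m" for x
    using bits_value_less[of "ceval (circuit_V I) x"] circuits by (simp add: ceval_def)
qed (use origin in auto)

section \<open>Meaning of the shared gates\<close>

definition decode :: "bool list \<Rightarrow> bool list \<times> nat" where
  "decode u = (take n u, bits_value (drop n u))"

lemma decode_inject:
  assumes "length u = n + k" "length v = n + k"
  shows "decode u = decode v \<longleftrightarrow> u = v"
proof
  assume "decode u = decode v"
  then have "take n u = take n v" "drop n u = drop n v"
    using assms bits_value_inject[of "drop n u" "drop n v"] by (auto simp: decode_def)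
  then show "u = v" by (metis append_take_drop_id)
qed simp

lemma decode_zeros: "decode (zeros (n + k)) = (zeros n, 0)"
  by (simp add: decode_def)

text \<open>Any valuation satisfying the body realises all three maps at once, so one analysis of
  the wires serves the three circuits.\<close>

lemma reduced_semantics:
  assumes sat: "sat w (n + k) body" and u: "word w 0 (n + k) = u"
  shows "decode (map w (vertex_outs succ_vertex succ_level)) = line.step (decode u)"
    "decode (map w (vertex_outs pred_vertex pred_level)) = line.back_step (decode u)"
    "bits_value (map w meter_outs) = line.meter (decode u)"
proof -
  define x where "x = word w 0 n"
  define p where "p = word w n k"
  define q where "q = bits_value p"
  have dec: "decode u = (x, q)"
    by (simp add: u[symmetric] decode_def word_add x_def q_def p_def)
  have secs: "\<forall>(a, gs)\<in>set sections. sat w a gs"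
    using sat sat_aligned[OF sections_aligned] by (simp add: body_def)
  note sats = secs[unfolded sections_def list.set ball_simps prod.case]
  note call = sat_call[where w = w]
  have S: "word w succ_at n = succ_of I x"
    using call[of "circuit_S I" callS 0 succ_at] sats circuits by (simp add: succ_of_def x_def)
  have P: "word w pred_at n = pred_of I x"
    using call[of "circuit_P I" callP 0 pred_at] sats circuits by (simp add: pred_of_def x_def)
  have eqS: "w (eqS + 10 * n) \<longleftrightarrow> succ_of I x = x"
    using sat_equal_gates[of w eqS succ_at 0 n] sats by (simp add: S x_def)
  have eqP: "w (eqP + 10 * n) \<longleftrightarrow> pred_of I x = x"
    using sat_equal_gates[of w eqP pred_at 0 n] sats by (simp add: P x_def)
  have Vx: "word w (low_at + 1) m = ceval (circuit_V I) x"
    using call[of "circuit_V I" callV 0 "low_at + 1"] sats circuits by (simp add: x_def)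
  have Vy: "word w (high_at + 1) m = ceval (circuit_V I) (succ_of I x)"
    using call[of "circuit_V I" callW succ_at "high_at + 1"] sats circuits by (simp add: S)
  have bits: "w low_at \<longleftrightarrow> pred_of I x \<noteq> x" "\<not> w even_low_at" "w high_at" "\<not> w even_high_at"
    using sats sat_formula_gates[of w "callV + n + gV" "Neg (Wire (eqP + 10 * n))"]
      sat_formula_gates[of w _ "Lit True"] sat_formula_gates[of w _ "Lit False"]
    by (auto simp: low_at_def eqP)
  have even: "word w (even_low_at + 1) m = ceval (circuit_V I) x"
    "word w (even_high_at + 1) m = ceval (circuit_V I) (succ_of I x)"
    using sats sat_copy_gates Vx Vy by metis+
  \<comment> \<open>Words start with the least significant bit, so a bit placed in front of a
    potential doubles it and adds that bit.\<close>
  have low: "bits_value (word w low_at k) = line.low x"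
    using Vx bits by (simp add: k_def word_Suc' line.low_def)
  have high: "bits_value (word w high_at k) = line.high x"
    using Vy bits by (simp add: k_def word_Suc' line.high_def)
  have even_low: "bits_value (word w even_low_at k) = 2 * bits_value (ceval (circuit_V I) x)"
    using even bits by (simp add: k_def word_Suc')
  have even_high:
    "bits_value (word w even_high_at k) = 2 * bits_value (ceval (circuit_V I) (succ_of I x))"
    using even bits by (simp add: k_def word_Suc')
  have is_low: "w (is_low + 10 * k) \<longleftrightarrow> q = line.low x"
    using sat_equal_gates[of w is_low n low_at k] sats
    by (simp add: q_def p_def low[symmetric] bits_value_inject)
  have is_high: "w (is_high + 10 * k) \<longleftrightarrow> q = 2 * bits_value (ceval (circuit_V I) (succ_of I x))"
    using sat_equal_gates[of w is_high n even_high_at k] sats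
    by (simp add: q_def p_def even_high[symmetric] bits_value_inject)
  have above_low: "w (above_low + 11 * k) \<longleftrightarrow> line.low x < q"
    using sat_less_gates[of w above_low low_at n k] sats by (simp add: q_def p_def low)
  have below_high: "w (below_high + 11 * k) \<longleftrightarrow> q < line.high x"
    using sat_less_gates[of w below_high n high_at k] sats by (simp add: q_def p_def high)
  have "w act = truth w (active_formula (eqS + 10 * n) (eqP + 10 * n) (is_low + 10 * k)
        (is_high + 10 * k) (above_low + 11 * k) (below_high + 11 * k))"
  proof (rule sat_formula_at)
    show "act = (borrow_at + 4 * k + 1) + steps (active_formula (eqS + 10 * n) (eqP + 10 * n)
        (is_low + 10 * k) (is_high + 10 * k) (above_low + 11 * k) (below_high + 11 * k))"
      by (simp add: active_formula_def act_def)
  qed (use sats in blast)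
  then have act: "w act \<longleftrightarrow> line.active x q"
    by (auto simp: active_formula_def line.active_def eqS eqP is_low is_high above_low below_high)
  have leave: "w leave \<longleftrightarrow> w act \<and> w (is_high + 10 * k)"
    using sat_formula_at[of w "act + 1" "Conj (Wire act) (Wire (is_high + 10 * k))" leave] sats
    by (simp add: leave_def del: formula_gates.simps)
  have enter: "w enter \<longleftrightarrow> w act \<and> w (is_low + 10 * k)"
    using sat_formula_at[of w "leave + 1" "Conj (Wire act) (Wire (is_low + 10 * k))" enter] sats
    by (simp add: enter_def del: formula_gates.simps)
  have vertex: "map (\<lambda>i. w (L + 8 * i + 7)) [0..<n] = (if w sel then word w y n else x)"
    if "sat w L (row 8 (\<lambda>i. vertex_formula sel (y + i) i) n L)" for L sel y
    using sat_row[OF that] by (auto simp: formula_defs word_def x_def)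
  have level: "map (\<lambda>i. w (L + 23 * i + 22)) [0..<k] = (if w sel then word w b k
      else if w act then map (\<lambda>i. w (n + i) \<noteq> w (c + r * i)) [0..<k] else p)"
    if "sat w L (row 23 (\<lambda>i. level_formula sel act (b + i) (n + i) (c + r * i)) k L)" for L sel b c r
    using sat_row[OF that] by (auto simp: formula_defs word_def p_def)
  have inc: "bits_value (map (\<lambda>i. w (n + i) \<noteq> w (carry_at + 3 * i)) [0..<k]) +
      2 ^ k * of_bool (w (carry_at + 3 * k)) = q + 1"
    using sat_carry_gates[of w carry_at n k] sats by (simp add: q_def p_def)
  have dec': "bits_value (map (\<lambda>i. w (n + i) \<noteq> w (borrow_at + 4 * i)) [0..<k]) + 1 =
      q + 2 ^ k * of_bool (w (borrow_at + 4 * k))"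
    using sat_borrow_gates[of w borrow_at n k] sats by (simp add: q_def p_def)
  \<comment> \<open>The final carry has weight \<open>2 ^ k\<close>; dropping it is reduction modulo
    \<open>2 ^ k\<close>.\<close>
  have inc_mod: "bits_value (map (\<lambda>i. w (n + i) \<noteq> w (carry_at + 3 * i)) [0..<k]) = (q + 1) mod 2 ^ k"
    using bits_value_less[of "map (\<lambda>i. w (n + i) \<noteq> w (carry_at + 3 * i)) [0..<k]"]
    unfolding inc[symmetric] by simp
  have dec_mod: "bits_value (map (\<lambda>i. w (n + i) \<noteq> w (borrow_at + 4 * i)) [0..<k]) =
      (q + 2 ^ k - 1) mod 2 ^ k" (is "?b = _")
  proof -
    have b: "?b < 2 ^ k"
      using bits_value_less[of "map (\<lambda>i. w (n + i) \<noteq> w (borrow_at + 4 * i)) [0..<k]"] by simp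
    \<comment> \<open>With a final borrow the result has already wrapped around; without one the
      summand \<open>2 ^ k\<close> is still in excess and vanishes modulo
      \<open>2 ^ k\<close>.\<close>
    have "q + 2 ^ k - 1 = ?b \<or> q + 2 ^ k - 1 = ?b + 2 ^ k"
      using dec' by (cases "w (borrow_at + 4 * k)") auto
    then show ?thesis using b by auto
  qed
  have succ_vertex: "map (\<lambda>i. w (succ_vertex + 8 * i + 7)) [0..<n] = (if w leave then succ_of I x else x)"
    unfolding S[symmetric] by (rule vertex) (use sats in blast)
  have pred_vertex: "map (\<lambda>i. w (pred_vertex + 8 * i + 7)) [0..<n] = (if w enter then pred_of I x else x)"
    unfolding P[symmetric] by (rule vertex) (use sats in blast)
  have succ_level: "map (\<lambda>i. w (succ_level + 23 * i + 22)) [0..<k] = (if w leave then word w high_at k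
      else if w act then map (\<lambda>i. w (n + i) \<noteq> w (carry_at + 3 * i)) [0..<k] else p)"
    using level sats by blast
  have pred_level: "map (\<lambda>i. w (pred_level + 23 * i + 22)) [0..<k] = (if w enter then word w even_low_at k
      else if w act then map (\<lambda>i. w (n + i) \<noteq> w (borrow_at + 4 * i)) [0..<k] else p)"
    using level sats by blast
  have lens: "length (succ_of I x) = n" "length (pred_of I x) = n" "length x = n"
    using circuits by (simp_all add: succ_of_def pred_of_def ceval_def x_def)
  have decode_append: "decode (ys @ zs) = (ys, bits_value zs)" if "length ys = n" for ys zs
    using that by (simp add: decode_def)
  show "decode (map w (vertex_outs succ_vertex succ_level)) = line.step (decode u)"
    unfolding dec vertex_outs_def map_append map_map comp_def succ_vertex succ_level
      line.step.simps k_def[symmetric]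
    by (subst decode_append) (auto simp: lens act leave is_high high inc_mod[simplified] q_def)
  show "decode (map w (vertex_outs pred_vertex pred_level)) = line.back_step (decode u)"
    unfolding dec vertex_outs_def map_append map_map comp_def pred_vertex pred_level
      line.back_step.simps k_def[symmetric]
    by (subst decode_append) (auto simp: lens act enter is_low even_low dec_mod[simplified] q_def)
  have "map (\<lambda>i. w (meter_at + 11 * i + 10)) [0..<k] =
      (if w act then map (\<lambda>i. w (n + i) \<noteq> w (carry_at + 3 * i)) [0..<k] else zeros k)"
    using sats sat_row[of w meter_at 11 "\<lambda>i. meter_formula act (n + i) (carry_at + 3 * i)" k]
    by (auto simp: formula_defs list_eq_iff_nth_eq)
  moreover have "w meter_top \<longleftrightarrow> w act \<and> w (carry_at + 3 * k)"
    using sat_formula_at[of w "meter_at + 11 * k" "Conj (Wire act) (Wire (carry_at + 3 * k))" meter_top]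
      sats by (simp add: meter_top_def del: formula_gates.simps)
  moreover have "map (\<lambda>i. w false_at) [0..<n] = zeros n"
    using sats sat_formula_gates[of w false_at "Lit False"] by (simp add: list_eq_iff_nth_eq)
  \<comment> \<open>On active vertices the sum bits and the final carry together are worth
    \<open>q + 1\<close>; otherwise all bits are masked to zero.\<close>
  ultimately show "bits_value (map w meter_outs) = line.meter (decode u)"
    unfolding dec meter_outs_def map_append map_map comp_def
    using inc by (simp add: act[symmetric] bits_value_append)
qed

end


section \<open>Correctness of the reduction\<close>

context valid_reduction
begin

text \<open>Wire values do not depend on the list of outputs, so a circuit without outputs can stand
  for all three.\<close>

definition wire_values :: "bool list \<Rightarrow> nat \<Rightarrow> bool" where
  "wire_values u = (!) (wires (with_outputs []) u)"

lemma ceval_with_outputs: "ceval (with_outputs os) u = map (wire_values u) os"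
  by (simp add: ceval_def wire_values_def wires_def with_outputs_def)

lemma circuit_wf_with_outputs: "(\<And>j. j \<in> set os \<Longrightarrow> j \<le> false_at) \<Longrightarrow> circuit_wf (with_outputs os)"
  using body_ok body_length by (auto simp: circuit_wf_def with_outputs_def gates_ok_def less_Suc_eq_le)

lemma outs_bound:
  "j \<in> set (vertex_outs succ_vertex succ_level) \<Longrightarrow> j \<le> false_at"
  "j \<in> set (vertex_outs pred_vertex pred_level) \<Longrightarrow> j \<le> false_at"
  "j \<in> set meter_outs \<Longrightarrow> j \<le> false_at"
  unfolding vertex_outs_def meter_outs_def
  by (auto; use layout in linarith)+

lemma is_circuit_with_outputs:
  "is_circuit (n + k) (n + k) (circuit_S reduced)"
  "is_circuit (n + k) (n + k) (circuit_P reduced)"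
  "is_circuit (n + k) (n + k + 1) (circuit_V reduced)"
proof -
  have "circuit_wf (with_outputs (vertex_outs succ_vertex succ_level))"
    "circuit_wf (with_outputs (vertex_outs pred_vertex pred_level))"
    "circuit_wf (with_outputs meter_outs)"
    by (rule circuit_wf_with_outputs, erule outs_bound)+
  moreover have "inputs (with_outputs os) = n + k" "outputs (with_outputs os) = os" for os
    by (simp_all add: with_outputs_def)
  ultimately show "is_circuit (n + k) (n + k) (circuit_S reduced)"
    "is_circuit (n + k) (n + k) (circuit_P reduced)"
    "is_circuit (n + k) (n + k + 1) (circuit_V reduced)"
    by (simp_all add: is_circuit_def reduced_def vertex_outs_def meter_outs_def)
qed

lemma reduced_maps:
  assumes "length u = n + k"
  shows "decode (succ_of reduced u) = line.step (decode u)"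
    "decode (pred_of reduced u) = line.back_step (decode u)"
    "val_of reduced u = int (line.meter (decode u))"
proof -
  have wf: "circuit_wf (with_outputs [])"
    by (rule circuit_wf_with_outputs) simp
  have len: "length u = inputs (with_outputs [])"
    using assms by (simp add: with_outputs_def)
  have sat: "sat (wire_values u) (n + k) body"
    using wires_sat(1)[OF wf len] by (simp add: wire_values_def with_outputs_def)
  have u: "word (wire_values u) 0 (n + k) = u"
    using wires_sat(2)[OF wf len] assms by (simp add: word_eq_iff wire_values_def with_outputs_def)
  show "decode (succ_of reduced u) = line.step (decode u)"
    "decode (pred_of reduced u) = line.back_step (decode u)"
    "val_of reduced u = int (line.meter (decode u))"
    using reduced_semantics[OF sat u]
    by (simp_all add: succ_of_def pred_of_def val_of_def reduced_def ceval_with_outputs)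
qed

lemma length_reduced: "length (succ_of reduced u) = n + k" "length (pred_of reduced u) = n + k"
  by (simp_all add: succ_of_def pred_of_def ceval_def reduced_def with_outputs_def vertex_outs_def)

lemma dim_reduced: "dim reduced = n + k"
  by (simp add: dim_def reduced_def with_outputs_def)

lemma EOML_instance_reduced: "EOML_instance reduced"
proof -
  have "val_of reduced u \<le> 2 ^ (n + k)" if u: "length u = n + k" for u
  proof -
    have "bits_value (drop n u) < 2 ^ k"
      using bits_value_less[of "drop n u"] u by simp
    then have "line.meter (decode u) \<le> 2 ^ k"
      by (simp add: decode_def)
    also have "\<dots> \<le> 2 ^ (n + k)" by (simp add: power_increasing)
    finally have "int (line.meter (decode u)) \<le> int (2 ^ (n + k))"
      unfolding of_nat_le_iff .
    then show ?thesis
      using reduced_maps(3)[OF u] by simp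
  qed
  moreover have "pred_of reduced (zeros (n + k)) = zeros (n + k)"
    using reduced_maps(2)[of "zeros (n + k)"] line.back_step_origin
      decode_inject[of "pred_of reduced (zeros (n + k))" "zeros (n + k)"]
    by (simp add: decode_zeros length_reduced del: line.back_step.simps)
  moreover have "succ_of reduced (zeros (n + k)) \<noteq> zeros (n + k)"
    using reduced_maps(1)[of "zeros (n + k)"] line.step_origin
    by (metis decode_zeros length_replicate)
  moreover have "val_of reduced (zeros (n + k)) = 1"
    using reduced_maps(3)[of "zeros (n + k)"] line.meter_origin
    by (simp only: decode_zeros length_replicate)
  ultimately show ?thesis
    using is_circuit_with_outputs by (simp add: EOML_instance_def Let_def dim_reduced)
qed

text \<open>By contraposition: for a sound \<open>x\<close>, \<open>no_violation\<close> refutes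
  each kind of solution on the level of pairs, and \<open>decode_inject\<close> carries the
  equalities back to bit strings of equal length.\<close>

lemma EOPL_solution_of_EOML_solution:
  assumes "EOML_solution reduced u"
  shows "EOPL_solution I (take n u)"
proof (rule ccontr)
  assume no: "\<not> EOPL_solution I (take n u)"
  define x where "x = take n u"
  define q where "q = bits_value (drop n u)"
  have dec: "decode u = (x, q)" by (simp add: decode_def x_def q_def)
  have u: "length u = n + k"
    using assms by (simp add: EOML_solution_def Let_def dim_reduced)
  then have "length x = n" by (simp add: x_def)
  with no have r1: "\<not> (succ_of I (pred_of I x) \<noteq> x \<and> x \<noteq> zeros n \<or> pred_of I (succ_of I x) \<noteq> x)"
    and r2: "\<not> (x \<noteq> succ_of I x \<and> pred_of I (succ_of I x) = x \<and>
      bits_value (ceval (circuit_V I) (succ_of I x)) \<le> bits_value (ceval (circuit_V I) x))"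
    by (auto simp: EOPL_solution_def Let_def dim x_def[symmetric] val_of_def)
  note nv = line.no_violation[OF r1 r2, of q, folded dec]
  have zero: "decode u = (zeros n, 0) \<longleftrightarrow> u = zeros (n + k)"
    using decode_inject[of u "zeros (n + k)"] u by (simp add: decode_zeros)
  have "succ_of reduced (pred_of reduced u) = u \<or> u = zeros (n + k)"
    using nv(1) decode_inject[of "succ_of reduced (pred_of reduced u)" u] u zero
    by (simp add: reduced_maps length_reduced)
  moreover have "pred_of reduced (succ_of reduced u) = u"
    using nv(2) decode_inject[of "pred_of reduced (succ_of reduced u)" u] u
    by (simp add: reduced_maps length_reduced)
  moreover have "val_of reduced u = 1 \<Longrightarrow> u = zeros (n + k)"
    using nv(3) u zero by (simp add: reduced_maps)
  moreover have "val_of reduced u > 0 \<Longrightarrow> val_of reduced (succ_of reduced u) - val_of reduced u = 1"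
    using nv(4) u by (simp add: reduced_maps length_reduced)
  moreover have "val_of reduced u > 1 \<Longrightarrow> val_of reduced u - val_of reduced (pred_of reduced u) = 1"
    using nv(5) u by (simp add: reduced_maps length_reduced)
  ultimately show False
    using assms unfolding EOML_solution_def Let_def dim_reduced by blast
qed

end


section \<open>Programs that emit circuits\<close>

lemma val_update: "expr_ok d e \<Longrightarrow> d \<le> r \<Longrightarrow> val h (\<rho>(r := v)) e = val h \<rho> e"
  by (induction e) auto

section \<open>Chains of bindings as systems of equations\<close>

fun binds :: "expr list \<Rightarrow> stmt \<Rightarrow> stmt" where
  "binds [] p = p"
| "binds (e # es) p = Bind e (binds es p)"

fun bound_env :: "(nat \<Rightarrow> nat \<Rightarrow> nat) \<Rightarrow> nat \<Rightarrow> expr list \<Rightarrow> (nat \<Rightarrow> nat) \<Rightarrow> nat \<Rightarrow> nat" where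
  "bound_env h d [] \<rho> = \<rho>"
| "bound_env h d (e # es) \<rho> = bound_env h (Suc d) es (\<rho>(d := val h \<rho> e))"

fun exprs_ok :: "nat \<Rightarrow> expr list \<Rightarrow> bool" where
  "exprs_ok d [] \<longleftrightarrow> True"
| "exprs_ok d (e # es) \<longleftrightarrow> expr_ok d e \<and> exprs_ok (Suc d) es"

text \<open>Without reassignment the final environment satisfies all binding equations
  simultaneously. For \<open>layout_exprs\<close> these equations mirror the definitions of the wire
  addresses.\<close>

fun solves :: "(nat \<Rightarrow> nat \<Rightarrow> nat) \<Rightarrow> nat \<Rightarrow> expr list \<Rightarrow> (nat \<Rightarrow> nat) \<Rightarrow> bool" where
  "solves h d [] \<sigma> \<longleftrightarrow> True"
| "solves h d (e # es) \<sigma> \<longleftrightarrow> \<sigma> d = val h \<sigma> e \<and> solves h (Suc d) es \<sigma>"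

lemma emitted_binds:
  "emitted h (binds es p) d \<rho> = emitted h p (d + length es) (bound_env h d es \<rho>)"
  by (induction es arbitrary: d \<rho>) auto

lemma stmt_ok_binds: "stmt_ok d (binds es p) \<longleftrightarrow> exprs_ok d es \<and> stmt_ok (d + length es) p"
  by (induction es arbitrary: d) auto

lemma bound_env_below: "r < d \<Longrightarrow> bound_env h d es \<rho> r = \<rho> r"
  by (induction es arbitrary: d \<rho>) auto

lemma val_bound_env: "expr_ok d e \<Longrightarrow> val h (bound_env h d es \<rho>) e = val h \<rho> e"
  by (induction e) (auto simp: bound_env_below)

lemma expr_ok_mono: "expr_ok d e \<Longrightarrow> d \<le> d' \<Longrightarrow> expr_ok d' e"
  by (induction e) auto

lemma expr_ok_Suc_Suc: "expr_ok d e \<Longrightarrow> expr_ok (Suc (Suc d)) e"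
  by (rule expr_ok_mono) auto

text \<open>An expression reads only registers below the one it is bound to, and later bindings do
  not touch those.\<close>

lemma solves_bound_env: "exprs_ok d es \<Longrightarrow> solves h d es (bound_env h d es \<rho>)"
proof (induction es arbitrary: d \<rho>)
  case (Cons e es)
  then have "expr_ok (Suc d) e" "expr_ok d e" by (auto intro: expr_ok_mono)
  with Cons show ?case
    by (simp add: val_bound_env bound_env_below val_update)
qed simp

definition encode_gates :: "gate list \<Rightarrow> nat list" where
  "encode_gates gs = concat (map encode_gate gs)"

lemma encode_gates_simps [simp]:
  "encode_gates [] = []"
  "encode_gates (g # gs) = encode_gate g @ encode_gates gs"
  "encode_gates (gs @ hs) = encode_gates gs @ encode_gates hs"
  by (simp_all add: encode_gates_def)

lemma encode_gates_concat: "encode_gates (concat gss) = concat (map encode_gates gss)"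
  by (induction gss) auto

lemma length_encode_gate [simp]: "length (encode_gate g) = 3"
  by (cases g) auto

lemma length_encode_gates [simp]: "length (encode_gates gs) = 3 * length gs"
  by (induction gs) auto

lemma nth_encode_gates:
  "i < length gs \<Longrightarrow> j < 3 \<Longrightarrow> encode_gates gs ! (3 * i + j) = encode_gate (gs ! i) ! j"
proof (induction gs arbitrary: i)
  case (Cons g gs)
  then show ?case by (cases i) (auto simp: nth_append)
qed simp

section \<open>Statements that print gates\<close>

definition triple :: "nat \<Rightarrow> expr \<Rightarrow> expr \<Rightarrow> stmt" where
  "triple c a b = Then (Emit (Num c)) (Then (Emit a) (Emit b))"

text \<open>The formula tree is unrolled in the program text; only the addresses at its leaves and
  the base address are evaluated at run time.\<close>

fun formula_stmt :: "expr formula \<Rightarrow> expr \<Rightarrow> stmt" where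
  "formula_stmt (Wire a) L = triple 2 a a"
| "formula_stmt (Lit b) L = triple 0 (Num (of_bool b)) (Num 0)"
| "formula_stmt (Neg f) L = Then (formula_stmt f L) (triple 1 (Plus L (Num (steps f))) (Num 0))"
| "formula_stmt (Conj f g) L = Then (formula_stmt f L)
     (Then (formula_stmt g (Plus L (Num (Suc (steps f)))))
       (triple 2 (Plus L (Num (steps f))) (Plus L (Num (Suc (steps f + steps g))))))"
| "formula_stmt (Disj f g) L = Then (formula_stmt f L)
     (Then (formula_stmt g (Plus L (Num (Suc (steps f)))))
       (triple 3 (Plus L (Num (steps f))) (Plus L (Num (Suc (steps f + steps g))))))"

lemma emitted_formula_stmt:
  "emitted h (formula_stmt f L) d \<rho> =
     encode_gates (formula_gates (map_formula (val h \<rho>) f) (val h \<rho> L))"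
  by (induction f arbitrary: L) (auto simp: triple_def steps_map_formula)

lemma stmt_ok_formula_stmt:
  "expr_ok d L \<Longrightarrow> (\<And>a. a \<in> set_formula f \<Longrightarrow> expr_ok d a) \<Longrightarrow> stmt_ok d (formula_stmt f L)"
  by (induction f arbitrary: L) (auto simp: triple_def)

fun scale :: "nat \<Rightarrow> expr \<Rightarrow> expr" where
  "scale 0 e = Num 0"
| "scale (Suc r) e = Plus e (scale r e)"

lemma val_scale [simp]: "val h \<rho> (scale r e) = r * val h \<rho> e"
  by (induction r) auto

lemma expr_ok_scale [simp]: "expr_ok d e \<Longrightarrow> expr_ok d (scale r e)"
  by (induction r) auto

text \<open>The register \<open>d\<close> is a parameter because \<open>F\<close> has to be applied
  to the loop index, which the loop keeps in register \<open>d + 1\<close>.\<close>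

definition row_stmt :: "nat \<Rightarrow> nat \<Rightarrow> (expr \<Rightarrow> expr formula) \<Rightarrow> expr \<Rightarrow> expr \<Rightarrow> stmt" where
  "row_stmt d r F k L =
     For k (formula_stmt (F (Var (d + 1))) (Plus L (scale r (Var (d + 1)))))"

lemma emitted_row_stmt:
  assumes "expr_ok d L"
    "\<And>i. map_formula (val h (\<rho>(d := val h \<rho> k, d + 1 := i))) (F (Var (d + 1))) = G i"
  shows "emitted h (row_stmt d r F k L) d \<rho> = encode_gates (row r G (val h \<rho> k) (val h \<rho> L))"
  using assms
  by (simp add: row_stmt_def row_def emitted_formula_stmt encode_gates_concat comp_def val_update)

lemma stmt_ok_row_stmt:
  assumes "expr_ok d k" "expr_ok d L" "0 < d"
    "\<And>a. a \<in> set_formula (F (Var (d + 1))) \<Longrightarrow> expr_ok (d + 2) a"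
  shows "stmt_ok d (row_stmt d r F k L)"
  using assms expr_ok_mono[OF assms(2), of "d + 2"]
  by (auto simp: row_stmt_def intro!: stmt_ok_formula_stmt)

text \<open>Operation codes are ordered by arity: 0 for constants, 1 for NOT, 2 and 3 for binary
  gates. Two comparisons thus tell which of the two remaining fields are wire numbers and must be
  relocated.\<close>

definition shift_stmt :: "nat \<Rightarrow> expr \<Rightarrow> expr \<Rightarrow> expr \<Rightarrow> stmt" where
  "shift_stmt d pos g off =
     (let a = (\<lambda>j. Arr 1 (Plus pos (Plus (scale 3 (Var (d + 1))) (Num j)))) in
      For g (Then (Emit (a 0)) (Then
        (IfLess (a 0) (Num 1) (Emit (a 1)) (Emit (Plus (a 1) off)))
        (IfLess (a 0) (Num 2) (Emit (a 2)) (Emit (Plus (a 2) off))))))"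

lemma emitted_shift_stmt:
  assumes ok: "expr_ok d pos" "expr_ok d off" and g: "val h \<rho> g = length gs"
    and h: "\<And>i j. i < length gs \<Longrightarrow> j < 3 \<Longrightarrow>
      h 1 (val h \<rho> pos + (3 * i + j)) = encode_gate (gs ! i) ! j"
  shows "emitted h (shift_stmt d pos g off) d \<rho> =
    encode_gates (map (shift_gate (val h \<rho> off)) gs)"
proof -
  let ?k = "val h \<rho> off"
  have a: "h (Suc 0) (val h \<rho> pos + 3 * i) = encode_gate (gs ! i) ! 0"
    "h (Suc 0) (Suc (val h \<rho> pos + 3 * i)) = encode_gate (gs ! i) ! 1"
    "h (Suc 0) (Suc (Suc (val h \<rho> pos + 3 * i))) = encode_gate (gs ! i) ! 2"
    if "i < length gs" for i
    using h[OF that, of 0] h[OF that, of 1] h[OF that, of 2] by simp_all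
  have "emitted h (shift_stmt d pos g off) d \<rho> =
      concat (map (\<lambda>i. encode_gate (shift_gate ?k (gs ! i))) [0..<length gs])"
    unfolding shift_stmt_def Let_def emitted.simps(3) g
  proof (intro arg_cong[of _ _ concat] map_cong refl, goal_cases)
    case (1 i)
    then have "i < length gs" by simp
    with ok show ?case by (cases "gs ! i") (simp_all add: val_update a)
  qed
  also have "\<dots> = encode_gates (map (shift_gate ?k) gs)"
    unfolding encode_gates_def map_map comp_def by (subst map_nth[symmetric, of gs]) (simp only: map_map comp_def)
  finally show ?thesis .
qed

lemma stmt_ok_shift_stmt:
  assumes "expr_ok d pos" "expr_ok d off" "expr_ok d g" "0 < d"
  shows "stmt_ok d (shift_stmt d pos g off)"
  using assms expr_ok_mono[OF assms(1), of "d + 2"] expr_ok_mono[OF assms(2), of "d + 2"]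
  by (simp add: shift_stmt_def Let_def)

text \<open>The language has no empty statement; a loop with limit 0 replaces it.\<close>

fun seq :: "stmt list \<Rightarrow> stmt" where
  "seq [] = For (Num 0) (Emit (Num 0))"
| "seq (p # ps) = Then p (seq ps)"

lemma emitted_seq: "emitted h (seq ps) d \<rho> = concat (map (\<lambda>p. emitted h p d \<rho>) ps)"
  by (induction ps) auto

lemma stmt_ok_seq: "stmt_ok d (seq ps) \<longleftrightarrow> (\<forall>p\<in>set ps. stmt_ok d p)"
  by (induction ps) auto

definition scan_stmt :: "nat \<Rightarrow> bool \<Rightarrow> nat \<Rightarrow> (expr \<Rightarrow> expr formula) \<Rightarrow> expr \<Rightarrow> expr \<Rightarrow> stmt" where
  "scan_stmt d b r F k L =
     Then (triple 0 (Num (of_bool b)) (Num 0)) (row_stmt d r F k (Plus L (Num 1)))"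

lemma emitted_scan_stmt:
  assumes "expr_ok d L"
    "\<And>i. map_formula (val h (\<rho>(d := val h \<rho> k, d + 1 := i))) (F (Var (d + 1))) = G i"
  shows "emitted h (scan_stmt d b r F k L) d \<rho> = encode_gates (scan b r G (val h \<rho> k) (val h \<rho> L))"
  using assms emitted_row_stmt[where L = "Plus L (Num 1)" and G = G]
  by (simp add: scan_stmt_def scan_def triple_def)

lemma stmt_ok_scan_stmt:
  assumes "expr_ok d k" "expr_ok d L" "0 < d"
    "\<And>a. a \<in> set_formula (F (Var (d + 1))) \<Longrightarrow> expr_ok (d + 2) a"
  shows "stmt_ok d (scan_stmt d b r F k L)"
  using assms by (auto simp: scan_stmt_def triple_def intro!: stmt_ok_row_stmt)

definition copy_stmt :: "nat \<Rightarrow> expr \<Rightarrow> expr \<Rightarrow> expr \<Rightarrow> stmt" where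
  "copy_stmt d a k L = row_stmt d 1 (\<lambda>i. Wire (Plus a i)) k L"

definition output_stmt :: "nat \<Rightarrow> expr \<Rightarrow> expr \<Rightarrow> expr \<Rightarrow> expr \<Rightarrow> stmt" where
  "output_stmt d pos off k L = row_stmt d 1 (\<lambda>i. Wire (Plus (Arr 1 (Plus pos i)) off)) k L"

definition eq_stmt :: "nat \<Rightarrow> expr \<Rightarrow> expr \<Rightarrow> expr \<Rightarrow> expr \<Rightarrow> stmt" where
  "eq_stmt d a b k L = scan_stmt d True 10
     (\<lambda>i. eq_formula (Wire (Plus L (scale 10 i))) (Plus a i) (Plus b i)) k L"

definition less_stmt :: "nat \<Rightarrow> expr \<Rightarrow> expr \<Rightarrow> expr \<Rightarrow> expr \<Rightarrow> stmt" where
  "less_stmt d a b k L = scan_stmt d False 11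
     (\<lambda>i. less_formula (Wire (Plus L (scale 11 i))) (Plus a i) (Plus b i)) k L"

definition carry_stmt :: "nat \<Rightarrow> expr \<Rightarrow> expr \<Rightarrow> expr \<Rightarrow> stmt" where
  "carry_stmt d a k L =
     scan_stmt d True 3 (\<lambda>i. Conj (Wire (Plus L (scale 3 i))) (Wire (Plus a i))) k L"

definition borrow_stmt :: "nat \<Rightarrow> expr \<Rightarrow> expr \<Rightarrow> expr \<Rightarrow> stmt" where
  "borrow_stmt d a k L =
     scan_stmt d True 4 (\<lambda>i. Conj (Wire (Plus L (scale 4 i))) (Neg (Wire (Plus a i)))) k L"

lemma emitted_copy_stmt:
  "expr_ok d a \<Longrightarrow> expr_ok d L \<Longrightarrow>
    emitted h (copy_stmt d a k L) d \<rho> = encode_gates (copy_gates (val h \<rho> a) (val h \<rho> k) (val h \<rho> L))"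
  unfolding copy_stmt_def copy_gates_def by (rule emitted_row_stmt) (simp_all add: val_update)

lemma emitted_eq_stmt:
  "expr_ok d a \<Longrightarrow> expr_ok d b \<Longrightarrow> expr_ok d L \<Longrightarrow> emitted h (eq_stmt d a b k L) d \<rho> =
    encode_gates (equal_gates (val h \<rho> a) (val h \<rho> b) (val h \<rho> k) (val h \<rho> L))"
  unfolding eq_stmt_def equal_gates_def
  by (rule emitted_scan_stmt) (simp_all add: val_update eq_formula_def)

lemma emitted_less_stmt:
  "expr_ok d a \<Longrightarrow> expr_ok d b \<Longrightarrow> expr_ok d L \<Longrightarrow> emitted h (less_stmt d a b k L) d \<rho> =
    encode_gates (less_gates (val h \<rho> a) (val h \<rho> b) (val h \<rho> k) (val h \<rho> L))"
  unfolding less_stmt_def less_gates_def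
  by (rule emitted_scan_stmt) (simp_all add: val_update less_formula_def)

lemma emitted_carry_stmt:
  "expr_ok d a \<Longrightarrow> expr_ok d L \<Longrightarrow> emitted h (carry_stmt d a k L) d \<rho> =
    encode_gates (carry_gates (val h \<rho> a) (val h \<rho> k) (val h \<rho> L))"
  unfolding carry_stmt_def carry_gates_def by (rule emitted_scan_stmt) (simp_all add: val_update)

lemma emitted_borrow_stmt:
  "expr_ok d a \<Longrightarrow> expr_ok d L \<Longrightarrow> emitted h (borrow_stmt d a k L) d \<rho> =
    encode_gates (borrow_gates (val h \<rho> a) (val h \<rho> k) (val h \<rho> L))"
  unfolding borrow_stmt_def borrow_gates_def by (rule emitted_scan_stmt) (simp_all add: val_update)

lemma emitted_output_stmt:
  assumes ok: "expr_ok d pos" "expr_ok d off" "expr_ok d L" and k: "val h \<rho> k = length os"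
    and h: "\<And>i. i < length os \<Longrightarrow> h 1 (val h \<rho> pos + i) = os ! i"
  shows "emitted h (output_stmt d pos off k L) d \<rho> =
    encode_gates (output_gates (val h \<rho> off) os (val h \<rho> L))"
proof -
  have "emitted h (output_stmt d pos off k L) d \<rho> =
      encode_gates (row 1 (\<lambda>i. Wire (h 1 (val h \<rho> pos + i) + val h \<rho> off)) (val h \<rho> k) (val h \<rho> L))"
    unfolding output_stmt_def by (rule emitted_row_stmt) (use ok in \<open>simp_all add: val_update\<close>)
  also have "row 1 (\<lambda>i. Wire (h 1 (val h \<rho> pos + i) + val h \<rho> off)) (val h \<rho> k) (val h \<rho> L) =
      output_gates (val h \<rho> off) os (val h \<rho> L)"
    unfolding output_gates_def row_def k by (intro arg_cong[of _ _ concat] map_cong) (auto simp: h[simplified])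
  finally show ?thesis .
qed

lemma stmt_ok_macros:
  assumes "0 < d"
  shows "expr_ok d a \<Longrightarrow> expr_ok d k \<Longrightarrow> expr_ok d L \<Longrightarrow> stmt_ok d (copy_stmt d a k L)"
    "expr_ok d a \<Longrightarrow> expr_ok d b \<Longrightarrow> expr_ok d k \<Longrightarrow> expr_ok d L \<Longrightarrow> stmt_ok d (output_stmt d a b k L)"
    "expr_ok d a \<Longrightarrow> expr_ok d b \<Longrightarrow> expr_ok d k \<Longrightarrow> expr_ok d L \<Longrightarrow> stmt_ok d (eq_stmt d a b k L)"
    "expr_ok d a \<Longrightarrow> expr_ok d b \<Longrightarrow> expr_ok d k \<Longrightarrow> expr_ok d L \<Longrightarrow> stmt_ok d (less_stmt d a b k L)"
    "expr_ok d a \<Longrightarrow> expr_ok d k \<Longrightarrow> expr_ok d L \<Longrightarrow> stmt_ok d (carry_stmt d a k L)"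
    "expr_ok d a \<Longrightarrow> expr_ok d k \<Longrightarrow> expr_ok d L \<Longrightarrow> stmt_ok d (borrow_stmt d a k L)"
  unfolding copy_stmt_def output_stmt_def eq_stmt_def less_stmt_def carry_stmt_def borrow_stmt_def
  using assms
  by (auto intro!: stmt_ok_row_stmt stmt_ok_scan_stmt
      simp: expr_ok_Suc_Suc eq_formula_def less_formula_def)


section \<open>A program for the reduction\<close>

definition vertex_stmt :: "nat \<Rightarrow> expr \<Rightarrow> expr \<Rightarrow> expr \<Rightarrow> expr \<Rightarrow> stmt" where
  "vertex_stmt d sel y k L = row_stmt d 8 (\<lambda>i. vertex_formula sel (Plus y i) i) k L"

definition level_stmt ::
  "nat \<Rightarrow> expr \<Rightarrow> expr \<Rightarrow> expr \<Rightarrow> expr \<Rightarrow> expr \<Rightarrow> nat \<Rightarrow> expr \<Rightarrow> expr \<Rightarrow> stmt" where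
  "level_stmt d sel a b q c r k L =
     row_stmt d 23 (\<lambda>i. level_formula sel a (Plus b i) (Plus q i) (Plus c (scale r i))) k L"

definition meter_stmt :: "nat \<Rightarrow> expr \<Rightarrow> expr \<Rightarrow> expr \<Rightarrow> expr \<Rightarrow> expr \<Rightarrow> stmt" where
  "meter_stmt d a q c k L =
     row_stmt d 11 (\<lambda>i. meter_formula a (Plus q i) (Plus c (scale 3 i))) k L"

lemma emitted_vertex_stmt:
  "expr_ok d sel \<Longrightarrow> expr_ok d y \<Longrightarrow> expr_ok d L \<Longrightarrow> emitted h (vertex_stmt d sel y k L) d \<rho> =
    encode_gates (row 8 (\<lambda>i. vertex_formula (val h \<rho> sel) (val h \<rho> y + i) i) (val h \<rho> k) (val h \<rho> L))"
  unfolding vertex_stmt_def by (rule emitted_row_stmt) (simp_all add: val_update formula_defs)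

lemma emitted_level_stmt:
  "expr_ok d sel \<Longrightarrow> expr_ok d a \<Longrightarrow> expr_ok d b \<Longrightarrow> expr_ok d q \<Longrightarrow> expr_ok d c \<Longrightarrow> expr_ok d L \<Longrightarrow>
    emitted h (level_stmt d sel a b q c r k L) d \<rho> =
    encode_gates (row 23 (\<lambda>i. level_formula (val h \<rho> sel) (val h \<rho> a) (val h \<rho> b + i)
      (val h \<rho> q + i) (val h \<rho> c + r * i)) (val h \<rho> k) (val h \<rho> L))"
  unfolding level_stmt_def by (rule emitted_row_stmt) (simp_all add: val_update formula_defs)

lemma emitted_meter_stmt:
  "expr_ok d a \<Longrightarrow> expr_ok d q \<Longrightarrow> expr_ok d c \<Longrightarrow> expr_ok d L \<Longrightarrow>
    emitted h (meter_stmt d a q c k L) d \<rho> =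
    encode_gates (row 11 (\<lambda>i. meter_formula (val h \<rho> a) (val h \<rho> q + i) (val h \<rho> c + 3 * i))
      (val h \<rho> k) (val h \<rho> L))"
  unfolding meter_stmt_def by (rule emitted_row_stmt) (simp_all add: val_update formula_defs)

lemma stmt_ok_row_macros:
  assumes "0 < d"
  shows "expr_ok d sel \<Longrightarrow> expr_ok d y \<Longrightarrow> expr_ok d k \<Longrightarrow> expr_ok d L \<Longrightarrow>
      stmt_ok d (vertex_stmt d sel y k L)"
    "expr_ok d sel \<Longrightarrow> expr_ok d a \<Longrightarrow> expr_ok d b \<Longrightarrow> expr_ok d q \<Longrightarrow> expr_ok d c \<Longrightarrow>
      expr_ok d k \<Longrightarrow> expr_ok d L \<Longrightarrow> stmt_ok d (level_stmt d sel a b q c r k L)"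
    "expr_ok d a \<Longrightarrow> expr_ok d q \<Longrightarrow> expr_ok d c \<Longrightarrow> expr_ok d k \<Longrightarrow> expr_ok d L \<Longrightarrow>
      stmt_ok d (meter_stmt d a q c k L)"
  unfolding vertex_stmt_def level_stmt_def meter_stmt_def
  using assms by (auto intro!: stmt_ok_row_stmt simp: expr_ok_Suc_Suc formula_defs)

text \<open>
  The registers are numbered in the order of \<open>layout_exprs\<close>; \<open>v_encP\<close>, \<open>v_encV\<close> and \<open>v_outS\<close>,
  \<open>v_outP\<close>, \<open>v_outV\<close> are positions in the encoding of the given instance.
\<close>

abbreviation "v_n \<equiv> Var 3"
abbreviation "v_gS \<equiv> Var 4"
abbreviation "v_outS \<equiv> Var 5"
abbreviation "v_encP \<equiv> Var 6"
abbreviation "v_gP \<equiv> Var 7"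
abbreviation "v_outP \<equiv> Var 8"
abbreviation "v_encV \<equiv> Var 9"
abbreviation "v_gV \<equiv> Var 10"
abbreviation "v_outV \<equiv> Var 11"
abbreviation "v_m \<equiv> Var 12"
abbreviation "v_k \<equiv> Var 13"
abbreviation "v_callS \<equiv> Var 14"
abbreviation "v_succ_at \<equiv> Var 15"
abbreviation "v_callP \<equiv> Var 16"
abbreviation "v_pred_at \<equiv> Var 17"
abbreviation "v_eqS \<equiv> Var 18"
abbreviation "v_eqP \<equiv> Var 19"
abbreviation "v_callV \<equiv> Var 20"
abbreviation "v_low_at \<equiv> Var 21"
abbreviation "v_even_low_at \<equiv> Var 22"
abbreviation "v_callW \<equiv> Var 23"
abbreviation "v_high_at \<equiv> Var 24"
abbreviation "v_even_high_at \<equiv> Var 25"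
abbreviation "v_is_low \<equiv> Var 26"
abbreviation "v_is_high \<equiv> Var 27"
abbreviation "v_above_low \<equiv> Var 28"
abbreviation "v_below_high \<equiv> Var 29"
abbreviation "v_carry_at \<equiv> Var 30"
abbreviation "v_borrow_at \<equiv> Var 31"
abbreviation "v_act \<equiv> Var 32"
abbreviation "v_leave \<equiv> Var 33"
abbreviation "v_enter \<equiv> Var 34"
abbreviation "v_succ_vertex \<equiv> Var 35"
abbreviation "v_succ_level \<equiv> Var 36"
abbreviation "v_pred_vertex \<equiv> Var 37"
abbreviation "v_pred_level \<equiv> Var 38"
abbreviation "v_meter_at \<equiv> Var 39"
abbreviation "v_meter_top \<equiv> Var 40"
abbreviation "v_false_at \<equiv> Var 41"
abbreviation "v_body_length \<equiv> Var 42"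

abbreviation plus_num :: "expr \<Rightarrow> nat \<Rightarrow> expr" where
  "plus_num e c \<equiv> Plus e (Num c)"

text \<open>Entry \<open>i\<close>, counted from 0, is bound to register \<open>i + 3\<close>;
  registers 1 and 2 are reserved for argument lengths. In positions of the encoding, three header
  words and three words per gate precede the outputs of a circuit.\<close>

definition layout_exprs :: "expr list" where
  "layout_exprs = [
    Arr 1 (Num 0),
    Arr 1 (Num 1),
    plus_num (scale 3 v_gS) 3,
    Plus v_outS v_n,
    Arr 1 (plus_num v_encP 1),
    Plus v_encP (plus_num (scale 3 v_gP) 3),
    Plus v_outP v_n,
    Arr 1 (plus_num v_encV 1),
    Plus v_encV (plus_num (scale 3 v_gV) 3),
    Arr 1 (plus_num v_encV 2),
    plus_num v_m 1,
    Plus v_n v_k,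
    Plus v_callS (Plus v_n v_gS),
    Plus v_succ_at v_n,
    Plus v_callP (Plus v_n v_gP),
    Plus v_pred_at v_n,
    Plus v_eqS (plus_num (scale 10 v_n) 1),
    Plus v_eqP (plus_num (scale 10 v_n) 1),
    Plus v_callV (Plus v_n (plus_num v_gV 1)),
    Plus v_low_at v_k,
    Plus v_even_low_at v_k,
    Plus v_callW (Plus v_n v_gV),
    Plus v_high_at v_k,
    Plus v_even_high_at v_k,
    Plus v_is_low (plus_num (scale 10 v_k) 1),
    Plus v_is_high (plus_num (scale 10 v_k) 1),
    Plus v_above_low (plus_num (scale 11 v_k) 1),
    Plus v_below_high (plus_num (scale 11 v_k) 1),
    Plus v_carry_at (plus_num (scale 3 v_k) 1),
    Plus v_borrow_at (plus_num (scale 4 v_k) 12),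
    plus_num v_act 3,
    plus_num v_leave 3,
    plus_num v_enter 1,
    Plus v_succ_vertex (scale 8 v_n),
    Plus v_succ_level (scale 23 v_k),
    Plus v_pred_vertex (scale 8 v_n),
    Plus v_pred_level (scale 23 v_k),
    Plus v_meter_at (plus_num (scale 11 v_k) 2),
    plus_num v_meter_top 1,
    Plus (scale 42 v_n) (Plus v_gS (Plus v_gP (Plus (scale 2 v_gV) (plus_num (scale 110 v_k) 31))))]"

abbreviation "depth \<equiv> 43"

definition section_stmts :: "stmt list" where
  "section_stmts = [
    copy_stmt depth (Num 0) v_n v_callS,
    shift_stmt depth (Num 3) v_gS v_callS,
    output_stmt depth v_outS v_callS v_n v_succ_at,
    copy_stmt depth (Num 0) v_n v_callP,
    shift_stmt depth (plus_num v_encP 3) v_gP v_callP,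
    output_stmt depth v_outP v_callP v_n v_pred_at,
    eq_stmt depth v_succ_at (Num 0) v_n v_eqS,
    eq_stmt depth v_pred_at (Num 0) v_n v_eqP,
    copy_stmt depth (Num 0) v_n v_callV,
    shift_stmt depth (plus_num v_encV 3) v_gV v_callV,
    formula_stmt (Neg (Wire (Plus v_eqP (scale 10 v_n)))) (Plus v_callV (Plus v_n v_gV)),
    output_stmt depth v_outV v_callV v_m (plus_num v_low_at 1),
    formula_stmt (Lit False) v_even_low_at,
    copy_stmt depth (plus_num v_low_at 1) v_m (plus_num v_even_low_at 1),
    copy_stmt depth v_succ_at v_n v_callW,
    shift_stmt depth (plus_num v_encV 3) v_gV v_callW,
    formula_stmt (Lit True) v_high_at,
    output_stmt depth v_outV v_callW v_m (plus_num v_high_at 1),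
    formula_stmt (Lit False) v_even_high_at,
    copy_stmt depth (plus_num v_high_at 1) v_m (plus_num v_even_high_at 1),
    eq_stmt depth v_n v_low_at v_k v_is_low,
    eq_stmt depth v_n v_even_high_at v_k v_is_high,
    less_stmt depth v_low_at v_n v_k v_above_low,
    less_stmt depth v_n v_high_at v_k v_below_high,
    carry_stmt depth v_n v_k v_carry_at,
    borrow_stmt depth v_n v_k v_borrow_at,
    formula_stmt (active_formula (Plus v_eqS (scale 10 v_n)) (Plus v_eqP (scale 10 v_n))
      (Plus v_is_low (scale 10 v_k)) (Plus v_is_high (scale 10 v_k))
      (Plus v_above_low (scale 11 v_k)) (Plus v_below_high (scale 11 v_k)))
      (plus_num (Plus v_borrow_at (scale 4 v_k)) 1),
    formula_stmt (Conj (Wire v_act) (Wire (Plus v_is_high (scale 10 v_k)))) (plus_num v_act 1),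
    formula_stmt (Conj (Wire v_act) (Wire (Plus v_is_low (scale 10 v_k)))) (plus_num v_leave 1),
    vertex_stmt depth v_leave v_succ_at v_n v_succ_vertex,
    level_stmt depth v_leave v_act v_high_at v_n v_carry_at 3 v_k v_succ_level,
    vertex_stmt depth v_enter v_pred_at v_n v_pred_vertex,
    level_stmt depth v_enter v_act v_even_low_at v_n v_borrow_at 4 v_k v_pred_level,
    meter_stmt depth v_act v_n v_carry_at v_k v_meter_at,
    formula_stmt (Conj (Wire v_act) (Wire (Plus v_carry_at (scale 3 v_k))))
      (Plus v_meter_at (scale 11 v_k)),
    formula_stmt (Lit False) v_false_at]"

definition line_stmt :: "expr \<Rightarrow> nat \<Rightarrow> nat \<Rightarrow> expr \<Rightarrow> stmt" where
  "line_stmt a r c k = For k (Emit (plus_num (Plus a (scale r (Var (depth + 1)))) c))"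

text \<open>\<open>v_callS\<close> holds \<open>n + k\<close>, the address of the first section and
  at the same time the number of inputs. An encoded instance has no sharing, so the body is printed
  once per circuit.\<close>

definition circuit_stmt :: "expr \<Rightarrow> stmt list \<Rightarrow> stmt" where
  "circuit_stmt l outs = seq ([Emit v_callS, Emit v_body_length, Emit l] @ section_stmts @ outs)"

text \<open>Stride 0 in the last \<open>line_stmt\<close> repeats the constant wire \<open>n\<close>
  times as padding.\<close>

definition reduction_program :: stmt where
  "reduction_program = binds layout_exprs (seq [
    circuit_stmt v_callS [line_stmt v_succ_vertex 8 7 v_n, line_stmt v_succ_level 23 22 v_k],
    circuit_stmt v_callS [line_stmt v_pred_vertex 8 7 v_n, line_stmt v_pred_level 23 22 v_k],
    circuit_stmt (plus_num v_callS 1)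
      [line_stmt v_meter_at 11 10 v_k, Emit v_meter_top, line_stmt v_false_at 0 0 v_n]])"

lemma reduction_program_ok: "stmt_ok 3 reduction_program"
proof -
  have "exprs_ok 3 layout_exprs"
    by (simp add: layout_exprs_def)
  moreover have "length layout_exprs = 40"
    by (simp add: layout_exprs_def)
  moreover have "\<forall>p\<in>set section_stmts. stmt_ok depth p"
    unfolding section_stmts_def list.set ball_simps
    by (intro conjI TrueI stmt_ok_macros stmt_ok_row_macros stmt_ok_shift_stmt stmt_ok_formula_stmt)
      (auto simp: formula_defs)
  ultimately show ?thesis
    by (simp add: reduction_program_def stmt_ok_binds stmt_ok_seq circuit_stmt_def line_stmt_def)
qed

context valid_reduction
begin

text \<open>The number of gates is printed before the gates, so the program needs it in closed form.
  The summand 31 collects the initial gates of the scans and all gates outside words and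
  rows.\<close>

lemma body_length': "length body = 42 * n + (gS + (gP + (2 * gV + (110 * k + 31))))"
  using body_length layout by linarith

lemma encode_instance_eq: "encode_instance I =
    [n, gS, n] @ encode_gates (gates (circuit_S I)) @ outputs (circuit_S I) @
    [n, gP, n] @ encode_gates (gates (circuit_P I)) @ outputs (circuit_P I) @
    [n, gV, m] @ encode_gates (gates (circuit_V I)) @ outputs (circuit_V I)"
  using circuits by (simp add: encode_instance_def encode_circuit_def encode_gates_def gS_def gP_def gV_def)

lemma emitted_reduction_program:
  assumes h: "\<And>j. j < length (encode_instance I) \<Longrightarrow> h 1 j = encode_instance I ! j"
  shows "emitted h reduction_program 3 \<rho> = encode_instance reduced"
proof -
  define \<sigma> where "\<sigma> = bound_env h 3 layout_exprs \<rho>"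
  have "exprs_ok 3 layout_exprs"
    by (simp add: layout_exprs_def)
  then have sol: "solves h 3 layout_exprs \<sigma>"
    unfolding \<sigma>_def by (rule solves_bound_env)
  note eqs = sol[unfolded layout_exprs_def solves.simps val.simps val_scale Suc_numeral Num.add_num_simps]
  \<comment> \<open>Reads a word from a segment \<open>B\<close> of the encoding whose predecessor
    \<open>A\<close> is known.\<close>
  have at: "h 1 a = B ! j"
    if "\<exists>C. encode_instance I = A @ B @ C" "j < length B" "a = length A + j" for A B a j
    using h[of a] that by (auto simp: nth_append)
  let ?S = "[n, gS, n] @ encode_gates (gates (circuit_S I))"
  let ?P = "?S @ outputs (circuit_S I) @ [n, gP, n] @ encode_gates (gates (circuit_P I))"
  let ?V = "?P @ outputs (circuit_P I) @ [n, gV, m] @ encode_gates (gates (circuit_V I))"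
  note lens [simp] = circuits gS_def[symmetric] gP_def[symmetric] gV_def[symmetric]
  have "h 1 0 = n" "h 1 1 = gS"
    using at[of "[]" "[n, gS, n]" 0 0] at[of "[]" "[n, gS, n]" 1 1] by (simp_all add: encode_instance_eq)
  moreover have "\<sigma> 3 = h 1 0" "\<sigma> 4 = h 1 1" "\<sigma> 5 = 3 * \<sigma> 4 + 3" "\<sigma> 6 = \<sigma> 5 + \<sigma> 3"
    using eqs by - (elim conjE, assumption)+
  ultimately have s3: "\<sigma> 3 = n" and s4: "\<sigma> 4 = gS" and s6: "\<sigma> 5 = 3 + 3 * gS" "\<sigma> 6 = 3 + 3 * gS + n"
    by simp_all
  \<comment> \<open>The positions depend on sizes read earlier: only with \<open>gS\<close> known
    can the second header be located, and only with \<open>gP\<close> known the third.\<close>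
  have "h 1 (\<sigma> 6 + 1) = gP"
    using at[of "?S @ outputs (circuit_S I)" "[n, gP, n]" 1 "\<sigma> 6 + 1"]
    by (simp add: encode_instance_eq s6)
  moreover have "\<sigma> 7 = h 1 (\<sigma> 6 + 1)" "\<sigma> 8 = \<sigma> 6 + (3 * \<sigma> 7 + 3)" "\<sigma> 9 = \<sigma> 8 + \<sigma> 3"
    using eqs by - (elim conjE, assumption)+
  ultimately have s7: "\<sigma> 7 = gP" and s9: "\<sigma> 8 = \<sigma> 6 + 3 + 3 * gP" "\<sigma> 9 = \<sigma> 6 + 3 + 3 * gP + n"
    by (simp_all add: s3)
  have "h 1 (\<sigma> 9 + 1) = gV" "h 1 (\<sigma> 9 + 2) = m"
    using at[of "?P @ outputs (circuit_P I)" "[n, gV, m]" 1 "\<sigma> 9 + 1"]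
      at[of "?P @ outputs (circuit_P I)" "[n, gV, m]" 2 "\<sigma> 9 + 2"]
    by (simp_all add: encode_instance_eq s6 s9)
  moreover have "\<sigma> 10 = h 1 (\<sigma> 9 + 1)" "\<sigma> 11 = \<sigma> 9 + (3 * \<sigma> 10 + 3)" "\<sigma> 12 = h 1 (\<sigma> 9 + 2)"
    using eqs by - (elim conjE, assumption)+
  ultimately have s10: "\<sigma> 10 = gV" and s12: "\<sigma> 12 = m" and s11: "\<sigma> 11 = \<sigma> 9 + 3 + 3 * gV"
    by simp_all
  note params = s3 s4 s7 s10 s12
  have e: "\<sigma> 13 = \<sigma> 12 + 1"
    "\<sigma> 14 = \<sigma> 3 + \<sigma> 13"
    "\<sigma> 15 = \<sigma> 14 + (\<sigma> 3 + \<sigma> 4)"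
    "\<sigma> 16 = \<sigma> 15 + \<sigma> 3"
    "\<sigma> 17 = \<sigma> 16 + (\<sigma> 3 + \<sigma> 7)"
    "\<sigma> 18 = \<sigma> 17 + \<sigma> 3"
    "\<sigma> 19 = \<sigma> 18 + (10 * \<sigma> 3 + 1)"
    "\<sigma> 20 = \<sigma> 19 + (10 * \<sigma> 3 + 1)"
    "\<sigma> 21 = \<sigma> 20 + (\<sigma> 3 + (\<sigma> 10 + 1))"
    "\<sigma> 22 = \<sigma> 21 + \<sigma> 13"
    "\<sigma> 23 = \<sigma> 22 + \<sigma> 13"
    "\<sigma> 24 = \<sigma> 23 + (\<sigma> 3 + \<sigma> 10)"
    "\<sigma> 25 = \<sigma> 24 + \<sigma> 13"
    "\<sigma> 26 = \<sigma> 25 + \<sigma> 13"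
    "\<sigma> 27 = \<sigma> 26 + (10 * \<sigma> 13 + 1)"
    "\<sigma> 28 = \<sigma> 27 + (10 * \<sigma> 13 + 1)"
    "\<sigma> 29 = \<sigma> 28 + (11 * \<sigma> 13 + 1)"
    "\<sigma> 30 = \<sigma> 29 + (11 * \<sigma> 13 + 1)"
    "\<sigma> 31 = \<sigma> 30 + (3 * \<sigma> 13 + 1)"
    "\<sigma> 32 = \<sigma> 31 + (4 * \<sigma> 13 + 12)"
    "\<sigma> 33 = \<sigma> 32 + 3"
    "\<sigma> 34 = \<sigma> 33 + 3"
    "\<sigma> 35 = \<sigma> 34 + 1"
    "\<sigma> 36 = \<sigma> 35 + 8 * \<sigma> 3"
    "\<sigma> 37 = \<sigma> 36 + 23 * \<sigma> 13"
    "\<sigma> 38 = \<sigma> 37 + 8 * \<sigma> 3"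
    "\<sigma> 39 = \<sigma> 38 + 23 * \<sigma> 13"
    "\<sigma> 40 = \<sigma> 39 + (11 * \<sigma> 13 + 2)"
    "\<sigma> 41 = \<sigma> 40 + 1"
    "\<sigma> 42 = 42 * \<sigma> 3 + (\<sigma> 4 + (\<sigma> 7 + (2 * \<sigma> 10 + (110 * \<sigma> 13 + 31))))"
    using eqs by - (elim conjE, assumption)+
  \<comment> \<open>Each register is identified from its own equation and the registers found before
    it, so no unfolded address ever accumulates.\<close>
  have r13: "\<sigma> 13 = k" by (simp only: e(1) params k_def add_ac)
  have r14: "\<sigma> 14 = callS" by (simp only: e(2) params r13 callS_def add_ac)
  have r15: "\<sigma> 15 = succ_at" by (simp only: e(3) params r13 r14 succ_at_def add_ac)
  have r16: "\<sigma> 16 = callP" by (simp only: e(4) params r13 r15 callP_def add_ac)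
  have r17: "\<sigma> 17 = pred_at" by (simp only: e(5) params r13 r16 pred_at_def add_ac)
  have r18: "\<sigma> 18 = eqS" by (simp only: e(6) params r13 r17 eqS_def add_ac)
  have r19: "\<sigma> 19 = eqP" by (simp only: e(7) params r13 r18 eqP_def add_ac)
  have r20: "\<sigma> 20 = callV" by (simp only: e(8) params r13 r19 callV_def add_ac)
  have r21: "\<sigma> 21 = low_at" by (simp only: e(9) params r13 r20 low_at_def add_ac)
  have r22: "\<sigma> 22 = even_low_at" by (simp only: e(10) params r13 r21 even_low_at_def add_ac)
  have r23: "\<sigma> 23 = callW" by (simp only: e(11) params r13 r22 callW_def add_ac)
  have r24: "\<sigma> 24 = high_at" by (simp only: e(12) params r13 r23 high_at_def add_ac)
  have r25: "\<sigma> 25 = even_high_at" by (simp only: e(13) params r13 r24 even_high_at_def add_ac)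
  have r26: "\<sigma> 26 = is_low" by (simp only: e(14) params r13 r25 is_low_def add_ac)
  have r27: "\<sigma> 27 = is_high" by (simp only: e(15) params r13 r26 is_high_def add_ac)
  have r28: "\<sigma> 28 = above_low" by (simp only: e(16) params r13 r27 above_low_def add_ac)
  have r29: "\<sigma> 29 = below_high" by (simp only: e(17) params r13 r28 below_high_def add_ac)
  have r30: "\<sigma> 30 = carry_at" by (simp only: e(18) params r13 r29 carry_at_def add_ac)
  have r31: "\<sigma> 31 = borrow_at" by (simp only: e(19) params r13 r30 borrow_at_def add_ac)
  have r32: "\<sigma> 32 = act" by (simp only: e(20) params r13 r31 act_def add_ac)
  have r33: "\<sigma> 33 = leave" by (simp only: e(21) params r13 r32 leave_def add_ac)
  have r34: "\<sigma> 34 = enter" by (simp only: e(22) params r13 r33 enter_def add_ac)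
  have r35: "\<sigma> 35 = succ_vertex" by (simp only: e(23) params r13 r34 succ_vertex_def add_ac)
  have r36: "\<sigma> 36 = succ_level" by (simp only: e(24) params r13 r35 succ_level_def add_ac)
  have r37: "\<sigma> 37 = pred_vertex" by (simp only: e(25) params r13 r36 pred_vertex_def add_ac)
  have r38: "\<sigma> 38 = pred_level" by (simp only: e(26) params r13 r37 pred_level_def add_ac)
  have r39: "\<sigma> 39 = meter_at" by (simp only: e(27) params r13 r38 meter_at_def add_ac)
  have r40: "\<sigma> 40 = meter_top" by (simp only: e(28) params r13 r39 meter_top_def add_ac)
  have r41: "\<sigma> 41 = false_at" by (simp only: e(29) params r13 r40 false_at_def add_ac)
  have r42: "\<sigma> 42 = length body" by (simp only: e(30) params r13 body_length')
  note regs = r13 r14 r15 r16 r17 r18 r19 r20 r21 r22 r23 r24 r25 r26 r27 r28 r29 r30 r31 r32 r33 r34 r35 r36 r37 r38 r39 r40 r41 r42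
  have gate_at: "h 1 (3 + (3 * i + j)) = encode_gate (gates (circuit_S I) ! i) ! j"
    if "i < gS" "j < 3" for i j
    using at[of "[n, gS, n]" "encode_gates (gates (circuit_S I))" "3 * i + j" "3 + (3 * i + j)"] that
      nth_encode_gates[of i "gates (circuit_S I)" j]
    by (simp add: encode_instance_eq)
  have gate_atP: "h 1 (\<sigma> 6 + 3 + (3 * i + j)) = encode_gate (gates (circuit_P I) ! i) ! j"
    if "i < gP" "j < 3" for i j
    using at[of "?S @ outputs (circuit_S I) @ [n, gP, n]" "encode_gates (gates (circuit_P I))"
        "3 * i + j" "\<sigma> 6 + 3 + (3 * i + j)"] that
      nth_encode_gates[of i "gates (circuit_P I)" j]
    by (simp add: encode_instance_eq s6)
  have gate_atV: "h 1 (\<sigma> 9 + 3 + (3 * i + j)) = encode_gate (gates (circuit_V I) ! i) ! j"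
    if "i < gV" "j < 3" for i j
    using at[of "?P @ outputs (circuit_P I) @ [n, gV, m]" "encode_gates (gates (circuit_V I))"
        "3 * i + j" "\<sigma> 9 + 3 + (3 * i + j)"] that
      nth_encode_gates[of i "gates (circuit_V I)" j]
    by (simp add: encode_instance_eq s6 s9)
  have out_at: "h 1 (\<sigma> 5 + i) = outputs (circuit_S I) ! i" if "i < n" for i
    using at[of ?S "outputs (circuit_S I)" i "\<sigma> 5 + i"] that
    by (simp add: encode_instance_eq s6)
  have out_atP: "h 1 (\<sigma> 8 + i) = outputs (circuit_P I) ! i" if "i < n" for i
    using at[of ?P "outputs (circuit_P I)" i "\<sigma> 8 + i"] that
    by (simp add: encode_instance_eq s6 s9)
  have out_atV: "h 1 (\<sigma> 11 + i) = outputs (circuit_V I) ! i" if "i < m" for i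
    using at[of ?V "outputs (circuit_V I)" i "\<sigma> 11 + i"] that
    by (simp add: encode_instance_eq s6 s9 s11)
  have shifts:
    "emitted h (shift_stmt depth (Num 3) v_gS v_callS) depth \<sigma> =
      encode_gates (map (shift_gate callS) (gates (circuit_S I)))"
    "emitted h (shift_stmt depth (plus_num v_encP 3) v_gP v_callP) depth \<sigma> =
      encode_gates (map (shift_gate callP) (gates (circuit_P I)))"
    "emitted h (shift_stmt depth (plus_num v_encV 3) v_gV v_callV) depth \<sigma> =
      encode_gates (map (shift_gate callV) (gates (circuit_V I)))"
    "emitted h (shift_stmt depth (plus_num v_encV 3) v_gV v_callW) depth \<sigma> =
      encode_gates (map (shift_gate callW) (gates (circuit_V I)))"
    using gate_at gate_atP gate_atV
    by (subst emitted_shift_stmt, simp_all add: params regs)+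
  have outs:
    "emitted h (output_stmt depth v_outS v_callS v_n v_succ_at) depth \<sigma> =
      encode_gates (output_gates callS (outputs (circuit_S I)) succ_at)"
    "emitted h (output_stmt depth v_outP v_callP v_n v_pred_at) depth \<sigma> =
      encode_gates (output_gates callP (outputs (circuit_P I)) pred_at)"
    "emitted h (output_stmt depth v_outV v_callV v_m (plus_num v_low_at 1)) depth \<sigma> =
      encode_gates (output_gates callV (outputs (circuit_V I)) (low_at + 1))"
    "emitted h (output_stmt depth v_outV v_callW v_m (plus_num v_high_at 1)) depth \<sigma> =
      encode_gates (output_gates callW (outputs (circuit_V I)) (high_at + 1))"
    using out_at out_atP out_atV
    by (subst emitted_output_stmt, simp_all add: params regs)+
  \<comment> \<open>Statements and sections are listed in the same order, so the two lists can be
    compared entry by entry.\<close>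
  have "map (\<lambda>p. emitted h p depth \<sigma>) section_stmts = map (\<lambda>s. encode_gates (snd s)) sections"
    unfolding section_stmts_def sections_def list.map snd_conv shifts outs list.inject
    by (intro conjI refl)
      (simp_all add: emitted_copy_stmt emitted_eq_stmt emitted_less_stmt emitted_carry_stmt
        emitted_borrow_stmt emitted_vertex_stmt emitted_level_stmt emitted_meter_stmt
        emitted_formula_stmt active_formula_def params regs add.assoc del: formula_stmt.simps formula_gates.simps)
  then have body: "concat (map (\<lambda>p. emitted h p depth \<sigma>) section_stmts) = encode_gates body"
    by (simp add: body_def encode_gates_concat comp_def)
  have len: "3 + length layout_exprs = depth"
    by (simp add: layout_exprs_def)
  show ?thesis
    unfolding reduction_program_def emitted_binds len \<sigma>_def[symmetric]
    by (simp add: emitted_seq circuit_stmt_def body line_stmt_def params regs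
        encode_instance_def encode_circuit_def encode_gates_def[symmetric] reduced_def with_outputs_def
        vertex_outs_def meter_outs_def callS_def concat_map_singleton
        del: upt_Suc)
qed

end


section \<open>The reduction theorem\<close>

text \<open>Compilation starts at register 3, above the output length in register 0 and the lengths
  of up to two arguments.\<close>

lemma computes_within_compile:
  assumes ok: "stmt_ok 3 p"
    and t: "cost (arr (init_state args)) p 3 (reg (init_state args)) \<le> T"
    and out: "emitted (arr (init_state args)) p 3 (reg (init_state args)) = out"
  shows "computes_within (compile 3 p) args out T"
proof -
  have "matches 3 (init_state args) (arr (init_state args)) (reg (init_state args))"
    by (simp add: matches_def)
  from exec_compile[OF ok _ this] obtain s where
    s: "exec (compile 3 p) (init_state args)
        (cost (arr (init_state args)) p 3 (reg (init_state args))) s"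
      "result s = result (init_state args) @ out"
    using out by auto
  moreover have "result (init_state args) = []"
    by (simp add: result_def init_state_def)
  ultimately show ?thesis
    using t by (auto simp: computes_within_def)
qed

text \<open>Header entries and wire numbers are at most the size; the summand 3 in the first bound
  covers the operation codes.\<close>

lemma encode_circuit_bound:
  assumes "circuit_wf C"
  shows "v \<in> set (encode_circuit C) \<Longrightarrow> v \<le> circuit_size C + 3"
    "length (encode_circuit C) \<le> 3 * circuit_size C + 3"
proof -
  have "v \<le> circuit_size C + 3" if g: "g \<in> set (gates C)" and v: "v \<in> set (encode_gate g)" for g v
  proof -
    obtain i where i: "i < length (gates C)" "g = gates C ! i"
      using g by (metis in_set_conv_nth)
    have "j \<le> circuit_size C" if "j \<in> operands g" for j
    proof -
      have "j < inputs C + i" using assms i that by (simp add: circuit_wf_def)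
      then show ?thesis using i(1) by (simp add: circuit_size_def)
    qed
    moreover have "v \<le> 3 \<or> v \<in> operands g"
      using v by (cases g) auto
    ultimately show ?thesis by fastforce
  qed
  moreover have "v \<le> circuit_size C + 3" if "v \<in> set (outputs C)" for v
  proof -
    have "v < inputs C + length (gates C)" using assms that by (simp add: circuit_wf_def)
    then show ?thesis by (simp add: circuit_size_def)
  qed
  ultimately show "v \<in> set (encode_circuit C) \<Longrightarrow> v \<le> circuit_size C + 3"
    by (auto simp: encode_circuit_def circuit_size_def)
  show "length (encode_circuit C) \<le> 3 * circuit_size C + 3"
    using length_encode_gates[of "gates C"]
    by (simp add: encode_circuit_def circuit_size_def encode_gates_def)
qed

lemma encode_instance_bound:
  assumes "EOPL_instance I"
  shows "v \<in> set (encode_instance I) \<Longrightarrow> v \<le> 3 * instance_size I + 9"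
    "length (encode_instance I) \<le> 3 * instance_size I + 9"
proof -
  have wf: "circuit_wf (circuit_S I)" "circuit_wf (circuit_P I)" "circuit_wf (circuit_V I)"
    using assms by (auto simp: EOPL_instance_def Let_def is_circuit_def)
  show "v \<in> set (encode_instance I) \<Longrightarrow> v \<le> 3 * instance_size I + 9"
    using encode_circuit_bound(1)[OF wf(1), of v] encode_circuit_bound(1)[OF wf(2), of v]
      encode_circuit_bound(1)[OF wf(3), of v]
    by (auto simp: encode_instance_def instance_size_def)
  show "length (encode_instance I) \<le> 3 * instance_size I + 9"
    using encode_circuit_bound(2)[OF wf(1)] encode_circuit_bound(2)[OF wf(2)]
      encode_circuit_bound(2)[OF wf(3)]
    by (simp add: encode_instance_def instance_size_def)
qed

lemma reduction_poly_time:
  "poly_time_on {I. EOPL_instance I} (\<lambda>I. [encode_instance I]) encode_instance instance_size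
    reduction.reduced"
proof -
  obtain q where q: "\<And>h \<rho> B. bounded_by 3 h \<rho> B \<Longrightarrow> cost h reduction_program 3 \<rho> \<le> poly q B"
    using cost_poly_bound[OF reduction_program_ok] by blast
  show ?thesis
    unfolding poly_time_on_def
  \<comment> \<open>The polynomial \<open>[:9, 3:]\<close> bounds both the input words and the
    length register, three circuits contributing 3 each to the constant.\<close>
  proof (intro exI[of _ "compile 3 reduction_program"] exI[of _ "pcompose q [:9, 3:]"] ballI)
    fix I
    assume "I \<in> {I. EOPL_instance I}"
    then have I: "EOPL_instance I" by simp
    then interpret valid_reduction I by unfold_locales
    let ?s = "init_state [encode_instance I]"
    show "computes_within (compile 3 reduction_program) [encode_instance I] (encode_instance reduced)
        (poly (pcompose q [:9, 3:]) (instance_size I))"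
    proof (rule computes_within_compile[OF reduction_program_ok])
      have "bounded_by 3 (arr ?s) (reg ?s) (3 * instance_size I + 9)"
        using encode_instance_bound[OF I] by (auto simp: bounded_by_def init_state_def)
      from q[OF this] show "cost (arr ?s) reduction_program 3 (reg ?s) \<le>
          poly (pcompose q [:9, 3:]) (instance_size I)"
        by (simp add: poly_pcompose algebra_simps)
      show "emitted (arr ?s) reduction_program 3 (reg ?s) = encode_instance reduced"
        by (rule emitted_reduction_program) (simp add: init_state_def)
    qed
  qed
qed

section \<open>Mapping solutions back\<close>

definition project :: "line_instance \<times> bool list \<Rightarrow> bool list" where
  "project = (\<lambda>(I, y). take (inputs (circuit_S I)) y)"

text \<open>The first word of the encoded instance is the dimension, so the rest of the instance is
  never read. Register 4 is the loop index.\<close>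

definition project_program :: stmt where
  "project_program = For (Arr 1 (Num 0)) (Emit (Arr 2 (Var 4)))"

lemma project_linear_time:
  assumes "\<And>I y. (I, y) \<in> D \<Longrightarrow> inputs (circuit_S I) \<le> length y"
  shows "linear_time_on D (\<lambda>(I, y). [encode_instance I, encode_bits y]) encode_bits
    (\<lambda>(I, y). instance_size I) project"
  unfolding linear_time_on_def
\<comment> \<open>Each bit takes 6 steps: four to read and emit it, two for increment and test. The
  remaining 4 steps evaluate the limit, clear the index and fail the last test.\<close>
proof (rule exI[of _ "compile 3 project_program"], rule exI[of _ 6], rule exI[of _ 4], rule ballI)
  fix a
  assume "a \<in> D"
  obtain I y where a: "a = (I, y)" by (cases a)
  let ?n = "inputs (circuit_S I)" and ?s = "init_state [encode_instance I, encode_bits y]"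
  have n: "?n \<le> length y" using assms \<open>a \<in> D\<close> a by simp
  have h1: "arr ?s 1 0 = ?n"
    by (simp add: init_state_def encode_instance_def encode_circuit_def)
  have h2: "arr ?s 2 i = of_bool (y ! i)" if "i < ?n" for i
    using that n by (simp add: init_state_def encode_bits_def)
  have "computes_within (compile 3 project_program) [encode_instance I, encode_bits y]
      (encode_bits (take ?n y)) (6 * instance_size I + 4)"
  proof (rule computes_within_compile)
    show "stmt_ok 3 project_program"
      by (simp add: project_program_def)
    show "cost (arr ?s) project_program 3 (reg ?s) \<le> 6 * instance_size I + 4"
      using h1 by (simp add: project_program_def instance_size_def circuit_size_def)
    show "emitted (arr ?s) project_program 3 (reg ?s) = encode_bits (take ?n y)"
    proof -
      have "emitted (arr ?s) project_program 3 (reg ?s) = map (arr ?s 2) [0..<?n]"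
        using h1 by (simp add: project_program_def)
      also have "\<dots> = map (\<lambda>i. of_bool (y ! i)) [0..<?n]"
        using h2 by (intro map_cong) auto
      also have "\<dots> = encode_bits (take ?n y)"
        using n by (simp add: encode_bits_def list_eq_iff_nth_eq)
      finally show ?thesis .
    qed
  qed
  then show "computes_within (compile 3 project_program)
      ((\<lambda>(I, y). [encode_instance I, encode_bits y]) a) (encode_bits (project a))
      (6 * (\<lambda>(I, y). instance_size I) a + 4)"
    by (simp add: a project_def)
qed

theorem mainTheorem7:
  shows "\<exists>(red :: line_instance \<Rightarrow> line_instance)
          (back :: line_instance \<times> bool list \<Rightarrow> bool list).
      (\<forall>I. EOPL_instance I \<longrightarrow> EOML_instance (red I)) \<and>
      (\<forall>I y. EOPL_instance I \<and> EOML_solution (red I) y \<longrightarrow> EOPL_solution I (back (I, y))) \<and>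
      poly_time_on {I. EOPL_instance I}
        (\<lambda>I. [encode_instance I]) encode_instance instance_size red \<and>
      linear_time_on {(I, y). EOPL_instance I \<and> EOML_solution (red I) y}
        (\<lambda>(I, y). [encode_instance I, encode_bits y]) encode_bits
        (\<lambda>(I, y). instance_size I) back"
proof (intro exI conjI allI impI)
  show "EOML_instance (reduction.reduced I)" if "EOPL_instance I" for I
    by (rule valid_reduction.EOML_instance_reduced) (unfold_locales, rule that)
  show "EOPL_solution I (project (I, y))"
    if "EOPL_instance I \<and> EOML_solution (reduction.reduced I) y" for I y
  proof -
    interpret valid_reduction I by unfold_locales (use that in simp)
    show ?thesis
      using EOPL_solution_of_EOML_solution[of y] that by (simp add: project_def n_def)
  qed
  show "poly_time_on {I. EOPL_instance I} (\<lambda>I. [encode_instance I]) encode_instance instance_size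
      reduction.reduced"
    by (rule reduction_poly_time)
  show "linear_time_on {(I, y). EOPL_instance I \<and> EOML_solution (reduction.reduced I) y}
      (\<lambda>(I, y). [encode_instance I, encode_bits y]) encode_bits (\<lambda>(I, y). instance_size I) project"
  proof (rule project_linear_time)
    fix I y
    assume "(I, y) \<in> {(I, y). EOPL_instance I \<and> EOML_solution (reduction.reduced I) y}"
    then have I: "EOPL_instance I" "EOML_solution (reduction.reduced I) y" by auto
    interpret valid_reduction I by unfold_locales (use I in simp)
    show "inputs (circuit_S I) \<le> length y"
      using I(2) by (simp add: EOML_solution_def Let_def dim_reduced n_def)
  qed
qed

end
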